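(* Let $p>4$, and for each integer $k\ge 2$ let $X^{(k)}\in[0,1]^k$ be a uniform random $k$-vector. Then for any kernel $U\in L^p_{sym}([0,1]^2)$, the convergence $\delta_\square(U,\mathcal{U}_{X^{(k)}})\to 0$ (as $k\to\infty$) holds with probability $1$.
   Context: $L^p_{sym}([0,1]^2)$ is the set of symmetric real-valued measurable functions ("kernels") $U:[0,1]^2\to\mathbb{R}$ with $\left(\int_{[0,1]^2}|U|^p\right)^{1/p}<\infty$. Here $1\le p<\infty$. For a vector $X=(X_1,\dots,X_k)\in[0,1]^k$, $\mathcal{U}_X$ is the step function on $[0,1]^2$ with uniform steps of length $1/k$ in each variable, taking on $[(i-1)/k,i/k]\times[(j-1)/k,j/k]$ the value $U(X_i,X_j)$ if $i\ne j$ and $0$ if $i=j$. The cut norm of $W\in L^1([0,1]^2)$ is $\|W\|_\square=\sup_{S,T\subseteq[0,1]}\left|\int_{S\times T}W(x,y)\,dx\,dy\right|$ (supremum over measurable sets). The cut distance of $U_1,U_2\in L^1([0,1]^2)$ is $\delta_\square(U_1,U_2)=\inf_{\psi\in\Psi}\|U_1-U_2\circ\psi\|_\square$, where $\Psi$ is the set of measure preserving bijections $[0,1]\to[0,1]$ and $(U_2\circ\psi)(x,y)=U_2(\psi(x),\psi(y))$. *)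

theory Defs
  imports "HOL-Probability.Probability"
begin

text \<open>Kernels and other functions on the unit square are total functions on the plane; only their
  values on the square are ever used. ``Measurable'' means Lebesgue measurable.\<close>

abbreviation unit_square :: "(real \<times> real) set"
  where "unit_square \<equiv> {0..1} \<times> {0..1}"

definition Lp_sym :: "real \<Rightarrow> (real \<times> real \<Rightarrow> real) set"
  where "Lp_sym p =
    {U. U \<in> borel_measurable (lebesgue_on unit_square) \<and>
        (\<forall>x\<in>{0..1}. \<forall>y\<in>{0..1}. U (x, y) = U (y, x)) \<and>
        integrable (lebesgue_on unit_square) (\<lambda>z. \<bar>U z\<bar> powr p)}"

text \<open>The steps are half-open, so that they are disjoint. This differs from closed steps only on
  a null set, which affects neither the cut norm nor the cut distance.\<close>

definition step :: "nat \<Rightarrow> nat \<Rightarrow> real set"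
  where "step k i = {(real i - 1) / real k ..< real i / real k}"

definition sampled_kernel ::
    "nat \<Rightarrow> (real \<times> real \<Rightarrow> real) \<Rightarrow> (nat \<Rightarrow> real) \<Rightarrow> real \<times> real \<Rightarrow> real"
  where "sampled_kernel k U X z =
    (\<Sum>i\<in>{1..k}. \<Sum>j\<in>{1..k}.
       (if i \<noteq> j then U (X i, X j) else 0) * indicator (step k i \<times> step k j) z)"

text \<open>The supremum is a supremum of reals. For integrable \<open>W\<close> the set is bounded
  by the \<open>L\<^sup>1\<close> norm of \<open>W\<close>.\<close>

definition cut_norm :: "(real \<times> real \<Rightarrow> real) \<Rightarrow> real"
  where "cut_norm W =
    Sup {\<bar>LINT z:S \<times> T|lebesgue. W z\<bar> | S T.
           S \<in> sets lebesgue \<and> T \<in> sets lebesgue \<and> S \<subseteq> {0..1} \<and> T \<subseteq> {0..1}}"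

definition measure_preserving_bijections :: "(real \<Rightarrow> real) set"
  where "measure_preserving_bijections =
    {\<psi>. bij_betw \<psi> {0..1} {0..1} \<and>
        \<psi> \<in> lebesgue_on {0..1} \<rightarrow>\<^sub>M lebesgue_on {0..1} \<and>
        distr (lebesgue_on {0..1}) (lebesgue_on {0..1}) \<psi> = lebesgue_on {0..1}}"

definition cut_dist :: "(real \<times> real \<Rightarrow> real) \<Rightarrow> (real \<times> real \<Rightarrow> real) \<Rightarrow> real"
  where "cut_dist U\<^sub>1 U\<^sub>2 =
    (INF \<psi>\<in>measure_preserving_bijections. cut_norm (\<lambda>(x, y). U\<^sub>1 (x, y) - U\<^sub>2 (\<psi> x, \<psi> y)))"

text \<open>The uniform distribution on the cube \<open>[0,1]\<^sup>k\<close>. Vectors are indexed by \<open>{1..k}\<close> and, as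
  elements of a product space, are \<open>undefined\<close> at all other indices.\<close>

definition uniform_cube :: "nat \<Rightarrow> (nat \<Rightarrow> real) measure"
  where "uniform_cube k = (\<Pi>\<^sub>M i\<in>{1..k}. restrict_space lborel {0..1})"

definition uniform_random_vector :: "'a measure \<Rightarrow> nat \<Rightarrow> ('a \<Rightarrow> nat \<Rightarrow> real) \<Rightarrow> bool"
  where "uniform_random_vector M k X \<longleftrightarrow>
    X \<in> M \<rightarrow>\<^sub>M uniform_cube k \<and> distr M (uniform_cube k) X = uniform_cube k"

end

theory Submission imports Defs "HOL-Real_Asymp.Real_Asymp" begin

text \<open>The proof gives convergence even in \<open>L\<^sup>1\<close> after rearrangement. Approximate \<open>U\<close> in \<open>L\<^sup>1\<close> by a
  bounded continuous \<open>W\<close>, and rearrange \<open>[0,1]\<close> by permuting the steps so that the sample becomes sorted.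
  If the empirical distribution function is close to uniform, the sorted sample is close to the
  identity, and \<open>U - U\<^sub>X \<circ> \<psi>\<close> is controlled by \<open>\<parallel>U - W\<parallel>\<^sub>1\<close>, the modulus of continuity of \<open>W\<close>, the diagonal
  blocks, and the U-statistic of \<open>\<bar>U - W\<bar>\<close>. Since nothing is known about the joint law of the vectors for different
  \<open>k\<close>, the exceptional probabilities must be summable: for the empirical distribution this is
  Hoeffding's inequality, for the U-statistic it follows by truncation and the fourth moment.
  Borel--Cantelli then finishes the proof.\<close>

section \<open>Cut distance and permutations of steps\<close>

text \<open>Sorting moves sample points close to their positions, which helps only where nearby
  arguments give nearby values. A rough \<open>U\<close> therefore has to pass through
  \<open>W\<close>, at the price of the average of \<open>\<bar>U - W\<bar>\<close> over sampled
  pairs. This average need not concentrate around its mean: an upper bound by a fixed multiple of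
  the small mean is enough, and it tolerates the crude counting of pairs below. Markov's inequality
  for the untruncated sum would give a probability bound that does not decrease with k; the
  truncation is what creates decay.

  The vectors have Borel laws while \<open>U\<close> is only Lebesgue measurable, so the estimates
  concern a Borel version \<open>U'\<close>. Almost surely both agree at all sampled pairs with
  distinct indices. Pairs (x, x) lie in a null set, where nothing is known, but the sampled kernel
  is 0 on the diagonal blocks.

  The permutation depends on the sample point, yet no measurability question arises from it: outside
  explicit bad events a deterministic inequality bounds the cut distance.\<close>

text \<open>If \<open>W\<close> is not integrable on \<open>S \<times> T\<close>, its integral there is \<open>0\<close> by convention, and the bound still holds.\<close>

lemma cut_norm_bounds:
  assumes G: "set_integrable lebesgue unit_square G"
    and W: "\<And>z. z \<in> unit_square \<Longrightarrow> \<bar>W z\<bar> \<le> G z"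
  shows "0 \<le> cut_norm W" and "cut_norm W \<le> (LINT z:unit_square|lebesgue. G z)"
proof -
  let ?C = "{\<bar>LINT z:S \<times> T|lebesgue. W z\<bar> | S T.
           S \<in> sets lebesgue \<and> T \<in> sets lebesgue \<and> S \<subseteq> {0..1} \<and> T \<subseteq> {0..1}}"
  have G0: "0 \<le> (LINT z:unit_square|lebesgue. G z)"
    unfolding set_lebesgue_integral_def
    by (intro Bochner_Integration.integral_nonneg)
      (use W in \<open>force simp: indicator_def intro: order_trans[OF abs_ge_zero]\<close>)
  have le: "c \<le> (LINT z:unit_square|lebesgue. G z)" if "c \<in> ?C" for c
  proof -
    from that obtain S T where ST: "S \<subseteq> {0..1}" "T \<subseteq> {0..1}"
      and c: "c = \<bar>LINT z:S \<times> T|lebesgue. W z\<bar>" by blast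
    show ?thesis
    proof (cases "set_integrable lebesgue (S \<times> T) W")
      case True
      have "c \<le> (LINT z|lebesgue. \<bar>indicator (S \<times> T) z *\<^sub>R W z\<bar>)"
        unfolding c set_lebesgue_integral_def by (rule integral_abs_bound)
      also have "\<dots> \<le> (LINT z|lebesgue. indicator unit_square z *\<^sub>R G z)"
      proof (rule integral_mono)
        show "integrable lebesgue (\<lambda>z. \<bar>indicator (S \<times> T) z *\<^sub>R W z\<bar>)"
          using True unfolding set_integrable_def by (rule integrable_abs)
        show "integrable lebesgue (\<lambda>z. indicator unit_square z *\<^sub>R G z)"
          using G unfolding set_integrable_def .
        fix z
        show "\<bar>indicator (S \<times> T) z *\<^sub>R W z\<bar> \<le> indicator unit_square z *\<^sub>R G z"
        proof (cases "z \<in> unit_square")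
          case True
          then show ?thesis using W[OF True] abs_ge_zero[of "W z"]
            by (auto simp: indicator_def simp del: abs_ge_zero)
        next
          case False
          then have "z \<notin> S \<times> T" using ST by (cases z) blast
          with False show ?thesis by simp
        qed
      qed
      finally show ?thesis unfolding set_lebesgue_integral_def .
    next
      case False
      then have "c = 0"
        unfolding c set_lebesgue_integral_def set_integrable_def
        by (simp add: not_integrable_integral_eq)
      with G0 show ?thesis by simp
    qed
  qed
  have mem: "0 \<in> ?C"
    by (rule CollectI, rule exI[of _ "{}"], rule exI[of _ "{}"]) (auto simp: set_lebesgue_integral_def)
  have "bdd_above ?C" by (rule bdd_aboveI[of _ "LINT z:unit_square|lebesgue. G z"]) (rule le)
  then show "0 \<le> cut_norm W" unfolding cut_norm_def by (rule cSup_upper[OF mem])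
  show "cut_norm W \<le> (LINT z:unit_square|lebesgue. G z)"
    unfolding cut_norm_def by (rule cSup_least) (use mem le in blast)+
qed

lemma measure_preserving_bijections_id: "id \<in> measure_preserving_bijections"
  unfolding measure_preserving_bijections_def
  by (simp add: distr_id[unfolded id_def[symmetric]])

lemma measure_preserving_bijections_Icc:
  "\<psi> \<in> measure_preserving_bijections \<Longrightarrow> x \<in> {0..1} \<Longrightarrow> \<psi> x \<in> {0..1}"
  unfolding measure_preserving_bijections_def bij_betw_def by blast

lemma lmeasurable_unit_square: "unit_square \<in> lmeasurable"
proof -
  have "unit_square = cbox (0, 0) (1, 1)" by (simp add: cbox_Pair_eq)
  then show ?thesis by simp
qed

text \<open>A real infimum is informative only for a set that is bounded below. Every cut norm in
  question is nonnegative because \<open>\<bar>U\<bar> + B\<close> dominates the difference for each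
  bijection, so the infimum is nonnegative and lies below each of its members.\<close>

lemma cut_dist_bounds:
  assumes U: "set_integrable lebesgue unit_square U"
    and V: "\<And>z. z \<in> unit_square \<Longrightarrow> \<bar>V z\<bar> \<le> B"
  shows cut_dist_nonneg: "0 \<le> cut_dist U V"
    and cut_dist_le: "\<psi> \<in> measure_preserving_bijections \<Longrightarrow>
      cut_dist U V \<le> cut_norm (\<lambda>(x, y). U (x, y) - V (\<psi> x, \<psi> y))"
proof -
  have ge0: "0 \<le> cut_norm (\<lambda>(x, y). U (x, y) - V (\<psi> x, \<psi> y))"
    if "\<psi> \<in> measure_preserving_bijections" for \<psi>
  proof (rule cut_norm_bounds(1)[where G = "\<lambda>z. \<bar>U z\<bar> + B"])
    show "set_integrable lebesgue unit_square (\<lambda>z. \<bar>U z\<bar> + B)"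
      using lmeasurable_unit_square U
      by (intro set_integral_add set_integrable_abs)
         (auto simp: set_integrable_def fmeasurable_def less_top[symmetric])
    fix z :: "real \<times> real" assume z: "z \<in> unit_square"
    then have "(\<psi> (fst z), \<psi> (snd z)) \<in> unit_square"
      using measure_preserving_bijections_Icc[OF that] by (cases z) auto
    from V[OF this] show "\<bar>case z of (x, y) \<Rightarrow> U (x, y) - V (\<psi> x, \<psi> y)\<bar> \<le> \<bar>U z\<bar> + B"
      by (cases z) auto
  qed
  show "0 \<le> cut_dist U V"
    unfolding cut_dist_def
    by (rule cINF_greatest) (use measure_preserving_bijections_id ge0 in auto)
  show "cut_dist U V \<le> cut_norm (\<lambda>(x, y). U (x, y) - V (\<psi> x, \<psi> y))"
    if "\<psi> \<in> measure_preserving_bijections"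
    unfolding cut_dist_def
    by (rule cINF_lower[OF bdd_belowI2[of _ 0] that]) (rule ge0)
qed

lemma ex_sorting_permutation:
  fixes X :: "nat \<Rightarrow> 'a::linorder"
  obtains \<sigma> where "bij_betw \<sigma> {1..k} {1..k}"
    and "\<And>i j. 1 \<le> i \<Longrightarrow> i \<le> j \<Longrightarrow> j \<le> k \<Longrightarrow> X (\<sigma> i) \<le> X (\<sigma> j)"
proof -
  define xs where "xs = sort_key X [1..<k+1]"
  have len: "length xs = k" and dist: "distinct xs" and set: "set xs = {1..k}"
    and srt: "sorted (map X xs)"
    by (auto simp: xs_def)
  show ?thesis
  proof (rule that[of "\<lambda>i. xs ! (i - 1)"])
    have "bij_betw ((!) xs \<circ> (\<lambda>i. i - 1)) {1..k} {1..k}"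
    proof (rule bij_betw_trans)
      show "bij_betw (\<lambda>i. i - 1) {1..k} {..<k}"
        by (rule bij_betwI[where g = Suc]) auto
      show "bij_betw ((!) xs) {..<k} {1..k}"
        using bij_betw_nth[OF dist] len set by simp
    qed
    then show "bij_betw (\<lambda>i. xs ! (i - 1)) {1..k} {1..k}" by (simp add: o_def)
    show "X (xs ! (i - 1)) \<le> X (xs ! (j - 1))" if "1 \<le> i" "i \<le> j" "j \<le> k" for i j
      using sorted_nth_mono[OF srt, of "i - 1" "j - 1"] that len by auto
  qed
qed

section \<open>The half-open steps as a partition of [0,1)\<close>

lemma mem_step_iff:
  assumes "k > 0" "x \<ge> 0"
  shows "x \<in> step k i \<longleftrightarrow> i = nat \<lfloor>real k * x\<rfloor> + 1"
proof -
  have "x \<in> step k i \<longleftrightarrow> real i - 1 \<le> real k * x \<and> real k * x < real i"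
    using assms unfolding step_def by (auto simp: field_simps)
  also have "\<dots> \<longleftrightarrow> \<lfloor>real k * x\<rfloor> = int i - 1" by (simp add: floor_eq_iff)
  also have "\<dots> \<longleftrightarrow> i = nat \<lfloor>real k * x\<rfloor> + 1"
  proof -
    have "0 \<le> \<lfloor>real k * x\<rfloor>" using assms by simp
    then show ?thesis by linarith
  qed
  finally show ?thesis .
qed

lemma ex_step:
  assumes "k > 0" "0 \<le> x" "x < 1"
  obtains i where "i \<in> {1..k}" "x \<in> step k i"
proof -
  have "real k * x < real k" using assms by simp
  then have "nat \<lfloor>real k * x\<rfloor> + 1 \<in> {1..k}" using assms by (auto simp: Suc_le_eq nat_less_iff floor_less_iff)
  with mem_step_iff[OF assms(1,2)] that show ?thesis by blast
qed

text \<open>The bound \<open>i \<ge> 1\<close> forces \<open>x \<ge> 0\<close>, where the floor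
  determines the index. For negative \<open>x\<close> it would not, since \<open>nat\<close> sends
  all negative floors to 0.\<close>

lemma step_unique:
  assumes "k > 0" "i \<ge> 1" "x \<in> step k i" "x \<in> step k j"
  shows "i = j"
proof -
  have "0 \<le> (real i - 1) / real k" using assms by simp
  moreover have "(real i - 1) / real k \<le> x" using assms unfolding step_def by simp
  ultimately have "x \<ge> 0" by (rule order_trans)
  with mem_step_iff assms show ?thesis by metis
qed

lemma step_subset_Ico:
  assumes "i \<in> {1..k}"
  shows "step k i \<subseteq> {0..<1}"
proof -
  have "0 \<le> (real i - 1) / real k" "real i / real k \<le> 1" using assms by auto
  then show ?thesis unfolding step_def by (auto intro: order_trans less_le_trans)
qed

section \<open>Rearrangements of the interval that permute the steps\<close>

text \<open>No step contains the point 1: it gets index \<open>k + 1\<close>, falls into the last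
  branch and stays fixed. This makes the map a bijection of the closed interval, not merely one up
  to a null set.\<close>

definition block_permutation :: "nat \<Rightarrow> (nat \<Rightarrow> nat) \<Rightarrow> real \<Rightarrow> real"
  where "block_permutation k \<sigma> x =
    (let i = nat \<lfloor>real k * x\<rfloor> + 1 in if i \<le> k then x + (real (\<sigma> i) - real i) / real k else x)"

lemma block_permutation_step:
  assumes "i \<in> {1..k}" "x \<in> step k i"
  shows "block_permutation k \<sigma> x = x + (real (\<sigma> i) - real i) / real k"
    and "block_permutation k \<sigma> x \<in> step k (\<sigma> i)"
proof -
  have k: "k > 0" using assms by auto
  have x: "x \<ge> 0" using step_subset_Ico[OF assms(1)] assms(2) by auto
  show *: "block_permutation k \<sigma> x = x + (real (\<sigma> i) - real i) / real k"
    using mem_step_iff[OF k x, of i] assms unfolding block_permutation_def Let_def by auto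
  show "block_permutation k \<sigma> x \<in> step k (\<sigma> i)"
    using assms(2) unfolding * by (simp add: step_def diff_divide_distrib)
qed

lemma block_permutation_1: "k > 0 \<Longrightarrow> block_permutation k \<sigma> 1 = 1"
  unfolding block_permutation_def Let_def by simp

text \<open>Only one direction of inverse index maps is treated;
  \<open>bij_betw_block_permutation\<close> uses it for \<open>\<sigma>\<close> and then for its
  inverse.\<close>

lemma block_permutation_inverse:
  assumes k: "k > 0" and \<sigma>: "\<And>i. i \<in> {1..k} \<Longrightarrow> \<sigma> i \<in> {1..k}"
    and \<tau>: "\<And>i. i \<in> {1..k} \<Longrightarrow> \<tau> (\<sigma> i) = i" and x: "x \<in> {0..1}"
  shows "block_permutation k \<sigma> x \<in> {0..1}"
    and "block_permutation k \<tau> (block_permutation k \<sigma> x) = x"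
proof -
  have "block_permutation k \<sigma> x \<in> {0..1} \<and> block_permutation k \<tau> (block_permutation k \<sigma> x) = x"
  proof (cases "x = 1")
    case True
    then show ?thesis using block_permutation_1[OF k] by simp
  next
    case False
    then obtain i where i: "i \<in> {1..k}" "x \<in> step k i"
      using ex_step[OF k] x by (metis atLeastAtMost_iff less_eq_real_def)
    note s = block_permutation_step[OF i, of \<sigma>]
    note t = block_permutation_step[OF \<sigma>[OF i(1)] s(2), of \<tau>]
    have "block_permutation k \<tau> (block_permutation k \<sigma> x) = x"
      unfolding t(1) \<tau>[OF i(1)] unfolding s(1) by (simp add: diff_divide_distrib)
    moreover have "block_permutation k \<sigma> x \<in> {0..1}"
      using step_subset_Ico[OF \<sigma>[OF i(1)]] s(2) by fastforce
    ultimately show ?thesis by simp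
  qed
  then show "block_permutation k \<sigma> x \<in> {0..1}"
    and "block_permutation k \<tau> (block_permutation k \<sigma> x) = x" by auto
qed

lemma bij_betw_block_permutation:
  assumes k: "k > 0" and \<sigma>: "bij_betw \<sigma> {1..k} {1..k}"
  shows "bij_betw (block_permutation k \<sigma>) {0..1} {0..1}"
proof (rule bij_betwI[where g = "block_permutation k (inv_into {1..k} \<sigma>)"])
  note mem = bij_betwE[OF \<sigma>] bij_betwE[OF bij_betw_inv_into[OF \<sigma>]]
  note inv = bij_betw_inv_into_left[OF \<sigma>] bij_betw_inv_into_right[OF \<sigma>]
  note a = block_permutation_inverse[OF k, of \<sigma> "inv_into {1..k} \<sigma>"]
  note b = block_permutation_inverse[OF k, of "inv_into {1..k} \<sigma>" \<sigma>]
  show "block_permutation k \<sigma> \<in> {0..1} \<rightarrow> {0..1}"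
    using a(1) mem inv by blast
  show "block_permutation k (inv_into {1..k} \<sigma>) \<in> {0..1} \<rightarrow> {0..1}"
    using b(1) mem inv by blast
  show "block_permutation k (inv_into {1..k} \<sigma>) (block_permutation k \<sigma> x) = x" if "x \<in> {0..1}" for x
    using a(2) mem inv that by blast
  show "block_permutation k \<sigma> (block_permutation k (inv_into {1..k} \<sigma>) x) = x" if "x \<in> {0..1}" for x
    using b(2) mem inv that by blast
qed

lemma sets_lebesgue_step [simp, measurable]: "step k i \<in> sets lebesgue"
  unfolding step_def by simp

lemma emeasure_lebesgue_eq_sum_steps:
  assumes k: "k > 0" and A: "A \<in> sets lebesgue" "A \<subseteq> {0..1}"
  shows "emeasure lebesgue A = (\<Sum>i\<in>{1..k}. emeasure lebesgue (A \<inter> step k i))"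
proof -
  have eq: "A = (\<Union>i\<in>{1..k}. A \<inter> step k i) \<union> (A \<inter> {1})"
  proof (intro equalityI subsetI)
    fix x assume x: "x \<in> A"
    show "x \<in> (\<Union>i\<in>{1..k}. A \<inter> step k i) \<union> (A \<inter> {1})"
    proof (cases "x = 1")
      case False
      with x A have "0 \<le> x" "x < 1" by auto
      then obtain i where "i \<in> {1..k}" "x \<in> step k i" using ex_step[OF k] by blast
      then show ?thesis using x by blast
    qed (use x in simp)
  qed auto
  have null: "A \<inter> {1} \<in> null_sets lebesgue"
    unfolding negligible_iff_null_sets[symmetric] by (rule negligible_subset[of "{1}"]) auto
  have "emeasure lebesgue A = emeasure lebesgue (\<Union>i\<in>{1..k}. A \<inter> step k i)"
    by (subst eq, rule emeasure_Un_null_set[OF _ null]) (use A in auto)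
  also have "\<dots> = (\<Sum>i\<in>{1..k}. emeasure lebesgue (A \<inter> step k i))"
    by (rule sum_emeasure[symmetric])
       (use A step_unique[OF k] in \<open>auto simp: disjoint_family_on_def\<close>)
  finally show ?thesis .
qed

text \<open>On each step the map is a translation, so the part of a preimage in step
  \<open>i\<close> is a translate of the part of the set in step \<open>\<sigma> i\<close>. Adding
  over \<open>i\<close> and reindexing by \<open>\<sigma>\<close> gives equal measure. Measurability
  comes from the same decomposition together with the fixed point 1.\<close>

lemma block_permutation_mem:
  assumes k: "k > 0" and \<sigma>: "bij_betw \<sigma> {1..k} {1..k}"
  shows "block_permutation k \<sigma> \<in> measure_preserving_bijections"
proof -
  let ?\<psi> = "block_permutation k \<sigma>" and ?L = "lebesgue_on {0..1::real}"
  note bij = bij_betw_block_permutation[OF k \<sigma>]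
  have part: "?\<psi> -` A \<inter> step k i = (+) ((real i - real (\<sigma> i)) / real k) ` (A \<inter> step k (\<sigma> i))"
    if i: "i \<in> {1..k}" for A i
  proof (intro equalityI subsetI)
    fix x assume x: "x \<in> ?\<psi> -` A \<inter> step k i"
    then have "x = (real i - real (\<sigma> i)) / real k + ?\<psi> x" "?\<psi> x \<in> A \<inter> step k (\<sigma> i)"
      using block_permutation_step[OF i, of x \<sigma>] by (auto simp: diff_divide_distrib)
    then show "x \<in> (+) ((real i - real (\<sigma> i)) / real k) ` (A \<inter> step k (\<sigma> i))" by (rule image_eqI)
  next
    fix x assume "x \<in> (+) ((real i - real (\<sigma> i)) / real k) ` (A \<inter> step k (\<sigma> i))"
    then obtain y where y: "y \<in> A" "y \<in> step k (\<sigma> i)"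
      and x: "x = (real i - real (\<sigma> i)) / real k + y" by blast
    have xs: "x \<in> step k i" using y(2) unfolding x step_def by (simp add: diff_divide_distrib)
    moreover have "?\<psi> x = y"
      using block_permutation_step(1)[OF i xs, of \<sigma>] unfolding x by (simp add: diff_divide_distrib)
    ultimately show "x \<in> ?\<psi> -` A \<inter> step k i" using y by simp
  qed
  have part_sets: "?\<psi> -` A \<inter> step k i \<in> sets lebesgue"
    and part_emeasure: "emeasure lebesgue (?\<psi> -` A \<inter> step k i) = emeasure lebesgue (A \<inter> step k (\<sigma> i))"
    if i: "i \<in> {1..k}" and A: "A \<in> sets lebesgue" for A i
  proof -
    show "?\<psi> -` A \<inter> step k i \<in> sets lebesgue"
      unfolding part[OF i] by (rule lebesgue_sets_translation) (use A in simp)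
    \<comment> \<open>Read as an affine map with factor 1, the translation visibly leaves the
      measure unchanged.\<close>
    have "(+) d ` S = (\<lambda>x. 1 *\<^sub>R x + d) ` S" for d :: real and S by (simp add: add.commute)
    then show "emeasure lebesgue (?\<psi> -` A \<inter> step k i) = emeasure lebesgue (A \<inter> step k (\<sigma> i))"
      unfolding part[OF i] using emeasure_lebesgue_affine[of 1 _ "A \<inter> step k (\<sigma> i)"] by simp
  qed
  have vimage_sets: "?\<psi> -` A \<inter> {0..1} \<in> sets lebesgue" if A: "A \<in> sets lebesgue" for A
  proof -
    have "?\<psi> -` A \<inter> {0..1} = (\<Union>i\<in>{1..k}. ?\<psi> -` A \<inter> step k i) \<union> (A \<inter> {1})"
    proof (intro equalityI subsetI)
      fix x assume x: "x \<in> ?\<psi> -` A \<inter> {0..1}"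
      show "x \<in> (\<Union>i\<in>{1..k}. ?\<psi> -` A \<inter> step k i) \<union> (A \<inter> {1})"
      proof (cases "x = 1")
        case True
        then show ?thesis using x block_permutation_1[OF k, of \<sigma>] by simp
      next
        case False
        with x have "0 \<le> x" "x < 1" by auto
        then obtain i where "i \<in> {1..k}" "x \<in> step k i" using ex_step[OF k] by blast
        then show ?thesis using x by blast
      qed
    next
      fix x assume "x \<in> (\<Union>i\<in>{1..k}. ?\<psi> -` A \<inter> step k i) \<union> (A \<inter> {1})"
      then show "x \<in> ?\<psi> -` A \<inter> {0..1}"
        using step_subset_Ico[of _ k] block_permutation_1[OF k, of \<sigma>] by fastforce
    qed
    also have "\<dots> \<in> sets lebesgue"
      using part_sets[OF _ A] A by (intro sets.Un sets.finite_UN) auto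
    finally show ?thesis .
  qed
  have sub: "A \<in> sets lebesgue" "A \<subseteq> {0..1}" if "A \<in> sets ?L" for A
    using that by (auto simp: sets_restrict_space)
  have meas: "?\<psi> \<in> ?L \<rightarrow>\<^sub>M ?L"
  proof (rule measurableI)
    show "?\<psi> x \<in> space ?L" if "x \<in> space ?L" for x using bij_betwE[OF bij] that by simp
    fix A assume "A \<in> sets ?L"
    note vimage_sets[OF sub(1)[OF this]]
    then show "?\<psi> -` A \<inter> space ?L \<in> sets ?L" by (simp add: sets_restrict_space_iff)
  qed
  moreover have "distr ?L ?L ?\<psi> = ?L"
  proof (rule measure_eqI)
    fix A assume "A \<in> sets (distr ?L ?L ?\<psi>)"
    then have AL: "A \<in> sets ?L" by simp
    note A = sub[OF this]
    have "emeasure (distr ?L ?L ?\<psi>) A = emeasure lebesgue (?\<psi> -` A \<inter> {0..1})"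
      using AL by (simp add: emeasure_distr[OF meas] emeasure_restrict_space)
    also have "\<dots> = (\<Sum>i\<in>{1..k}. emeasure lebesgue (?\<psi> -` A \<inter> {0..1} \<inter> step k i))"
      by (rule emeasure_lebesgue_eq_sum_steps[OF k]) (use vimage_sets A in auto)
    also have "\<dots> = (\<Sum>i\<in>{1..k}. emeasure lebesgue (A \<inter> step k (\<sigma> i)))"
    proof (rule sum.cong[OF refl])
      fix i assume i: "i \<in> {1..k}"
      have "?\<psi> -` A \<inter> {0..1} \<inter> step k i = ?\<psi> -` A \<inter> step k i"
        using step_subset_Ico[OF i] by auto
      then show "emeasure lebesgue (?\<psi> -` A \<inter> {0..1} \<inter> step k i) = emeasure lebesgue (A \<inter> step k (\<sigma> i))"
        using part_emeasure[OF i A(1)] by simp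
    qed
    also have "\<dots> = (\<Sum>i\<in>{1..k}. emeasure lebesgue (A \<inter> step k i))"
      by (rule sum.reindex_bij_betw[OF \<sigma>])
    also have "\<dots> = emeasure lebesgue A"
      by (rule emeasure_lebesgue_eq_sum_steps[OF k A, symmetric])
    finally show "emeasure (distr ?L ?L ?\<psi>) A = emeasure ?L A"
      using A by (simp add: emeasure_restrict_space)
  qed simp
  ultimately show ?thesis
    using bij unfolding measure_preserving_bijections_def by simp
qed

section \<open>Values of the sampled kernel and position of the sorted sample\<close>

lemma sampled_kernel_on_step:
  assumes "i \<in> {1..k}" "j \<in> {1..k}" "x \<in> step k i" "y \<in> step k j"
  shows "sampled_kernel k U X (x, y) = (if i \<noteq> j then U (X i, X j) else 0)"
proof -
  have k: "k > 0" using assms(1) by simp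
  have "indicator (step k a \<times> step k b) (x, y) = (if a = i \<and> b = j then 1 else (0::real))"
    if "a \<in> {1..k}" "b \<in> {1..k}" for a b
  proof -
    have "x \<in> step k a \<longleftrightarrow> a = i" "y \<in> step k b \<longleftrightarrow> b = j"
      using step_unique[OF k, of a x i] step_unique[OF k, of b y j] that assms(3,4) by auto
    then show ?thesis by (simp add: indicator_def)
  qed
  then have "sampled_kernel k U X (x, y) = (\<Sum>a\<in>{1..k}. \<Sum>b\<in>{1..k}.
      if b = j then (if a = i then (if a \<noteq> b then U (X a, X b) else 0) else 0) else 0)"
    unfolding sampled_kernel_def by (intro sum.cong) auto
  also have "\<dots> = (\<Sum>a\<in>{1..k}. if a = i then (if a \<noteq> j then U (X a, X j) else 0) else 0)"
    using assms(2) by (simp add: sum.delta)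
  also have "\<dots> = (if i \<noteq> j then U (X i, X j) else 0)"
    using assms(1) by (simp add: sum.delta)
  finally show ?thesis .
qed

text \<open>Only finiteness of the bound matters: it supplies the constant required by
  \<open>cut_dist_bounds\<close>.\<close>

lemma sampled_kernel_bounded:
  "\<bar>sampled_kernel k U X z\<bar> \<le> (\<Sum>i\<in>{1..k}. \<Sum>j\<in>{1..k}. \<bar>U (X i, X j)\<bar>)"
  unfolding sampled_kernel_def
  by (intro order_trans[OF sum_abs] sum_mono) (auto simp: indicator_def)

text \<open>The i-th order statistic is an empirical quantile at level about i/k, and i/k is about
  \<open>x\<close> on step \<open>i\<close>. Upwards three units of 1/N accumulate: rounding
  \<open>x\<close> to the grid, the step length 1/k, and the error allowed in \<open>cdf\<close>.
  Knowing the empirical distribution at grid points suffices because it is monotone.\<close>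

lemma sorted_sample_close:
  fixes Y :: "nat \<Rightarrow> real"
  assumes mono: "\<And>i j. 1 \<le> i \<Longrightarrow> i \<le> j \<Longrightarrow> j \<le> k \<Longrightarrow> Y i \<le> Y j"
    and Y: "\<And>i. i \<in> {1..k} \<Longrightarrow> Y i \<in> {0..1}"
    and N: "0 < N" "N \<le> k"
    and cdf: "\<And>m. m \<le> N \<Longrightarrow>
      \<bar>real (card {i \<in> {1..k}. Y i \<le> real m / real N}) / real k - real m / real N\<bar> \<le> 1 / real N"
    and i: "i \<in> {1..k}" and x: "x \<in> step k i"
  shows "\<bar>Y i - x\<bar> \<le> 3 / real N"
proof -
  define c where "c m = card {i \<in> {1..k}. Y i \<le> real m / real N}" for m
  have k: "k > 0" using i by auto
  have kN: "1 / real k \<le> 1 / real N" using N by (simp add: frac_le)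
  have x1: "(real i - 1) / real k \<le> x" "x < real i / real k" "0 \<le> x" "x < 1"
    using x step_subset_Ico[OF i] unfolding step_def by auto
  \<comment> \<open>In sorted order the indices counted by \<open>c m\<close> form the initial
    segment \<open>{1..c m}\<close>, so comparing \<open>i\<close> with \<open>c m\<close> locates
    \<open>Y i\<close> relative to m/N.\<close>
  have below: "Y i \<le> real m / real N" if "i \<le> c m" for m
  proof (rule ccontr)
    assume "\<not> Y i \<le> real m / real N"
    then have "{j \<in> {1..k}. Y j \<le> real m / real N} \<subseteq> {1..<i}"
      using mono[of i] i by (force simp: not_le)
    then have "c m \<le> i - 1" unfolding c_def using card_mono[of "{1..<i}"] by fastforce
    with that i show False by auto
  qed
  have above: "real m / real N < Y i" if "c m < i" for m
  proof (rule ccontr)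
    assume "\<not> real m / real N < Y i"
    then have "{1..i} \<subseteq> {j \<in> {1..k}. Y j \<le> real m / real N}"
      using mono[of _ i] i by (force simp: not_less)
    then have "i \<le> c m" unfolding c_def using card_mono[of "{j \<in> {1..k}. Y j \<le> real m / real N}" "{1..i}"] by simp
    with that show False by simp
  qed
  define m where "m = nat \<lfloor>real N * x\<rfloor>"
  have "0 \<le> real N * x" using x1 by simp
  then have m: "real m \<le> real N * x" "real N * x < real m + 1" unfolding m_def by linarith+
  have mx: "real m / real N \<le> x" "x < real m / real N + 1 / real N"
    using m N by (simp_all add: field_simps)
  \<comment> \<open>If the grid point (m+3)/N lies beyond 1, then x + 3/N already exceeds 1 and the
    bound is trivial. Likewise x - 3/N is negative below when m < 2.\<close>
  have up: "Y i \<le> x + 3 / real N"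
  proof (cases "m + 3 \<le> N")
    case True
    have "real i / real k \<le> real (m + 2) / real N"
      using x1 kN mx N by (simp add: diff_divide_distrib add_divide_distrib)
    also have "\<dots> = real (m + 3) / real N - 1 / real N" by (simp add: add_divide_distrib)
    also have "\<dots> \<le> real (c (m + 3)) / real k"
      using cdf[OF True] unfolding c_def by linarith
    finally have "i \<le> c (m + 3)" using k by (simp add: divide_le_cancel)
    from below[OF this] mx show ?thesis by (simp add: add_divide_distrib)
  next
    case False
    then have "real N \<le> real m + 2" by linarith
    then have "1 \<le> real m / real N + 2 / real N" using N by (simp add: field_simps)
    moreover have "2 / real N \<le> 3 / real N" by (simp add: divide_right_mono)
    ultimately show ?thesis using Y[OF i] mx by auto
  qed
  have low: "x - 3 / real N \<le> Y i"
  proof (cases "m \<ge> 2")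
    case True
    have "m \<le> N" 
    proof -
      have "real N * x \<le> real N" using x1 by (simp add: mult_left_le)
      with m show ?thesis by linarith
    qed
    then have "m - 2 \<le> N" by simp
    have "real (c (m - 2)) / real k \<le> real (m - 2) / real N + 1 / real N"
      using cdf[OF \<open>m - 2 \<le> N\<close>] unfolding c_def by linarith
    also have "\<dots> = real m / real N - 1 / real N"
      using True by (simp add: of_nat_diff diff_divide_distrib)
    also have "\<dots> < x" using mx N by (smt (verit) divide_pos_pos of_nat_0_less_iff)
    also have "\<dots> < real i / real k" by (rule x1)
    finally have "c (m - 2) < i" using k by (simp add: divide_less_cancel)
    from above[OF this] mx True show ?thesis by (simp add: of_nat_diff diff_divide_distrib)
  next
    case False
    then have "real m \<le> 1" by linarith
    then have "real m / real N \<le> 1 / real N" by (simp add: divide_right_mono)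
    then have "x \<le> 3 / real N" using mx by (smt (verit) add_divide_distrib)
    then show ?thesis using Y[OF i] by auto
  qed
  from up low show ?thesis by linarith
qed

section \<open>Cut distance to a sampled kernel\<close>

lemma step_times_step:
  assumes "i \<in> {1..k}" "j \<in> {1..k}"
  shows "step k i \<times> step k j \<in> sets lborel" "step k i \<times> step k j \<subseteq> unit_square"
    and "emeasure lborel (step k i \<times> step k j) = ennreal (1 / (real k)\<^sup>2)"
proof -
  have m: "step k i \<in> sets lborel" for i unfolding step_def by simp
  show "step k i \<times> step k j \<in> sets lborel" unfolding lborel_prod[symmetric] using m by (intro pair_measureI)
  show "step k i \<times> step k j \<subseteq> unit_square"
    using step_subset_Ico[OF assms(1)] step_subset_Ico[OF assms(2)] by (intro Sigma_mono) auto
  have e: "emeasure lborel (step k i) = ennreal (1 / real k)" for i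
    unfolding step_def by (simp add: diff_divide_distrib divide_right_mono)
  have "emeasure lborel (step k i \<times> step k j) = emeasure lborel (step k i) * emeasure lborel (step k j)"
    unfolding lborel_prod[symmetric] using m by (intro lborel.emeasure_pair_measure_Times)
  then show "emeasure lborel (step k i \<times> step k j) = ennreal (1 / (real k)\<^sup>2)"
    unfolding e by (simp add: ennreal_mult[symmetric] power2_eq_square)
qed

lemma sampled_kernel_integral:
  shows sampled_kernel_integrable: "set_integrable lebesgue unit_square (sampled_kernel k U X)"
    and "(LINT z:unit_square|lebesgue. sampled_kernel k U X z) =
      (\<Sum>i\<in>{1..k}. \<Sum>j\<in>{1..k}. if i \<noteq> j then U (X i, X j) else 0) / (real k)\<^sup>2"
proof -
  have 1: "has_bochner_integral lebesgue (\<lambda>z. c * indicator (step k i \<times> step k j) z) (c / (real k)\<^sup>2)"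
    if "i \<in> {1..k}" "j \<in> {1..k}" for i j and c :: real
  proof -
    note s = step_times_step[OF that]
    have "has_bochner_integral lebesgue (indicator (step k i \<times> step k j)) (1 / (real k)\<^sup>2)"
      using has_bochner_integral_real_indicator[of "step k i \<times> step k j" lebesgue] s(1,3)
      by (simp add: measure_def)
    from has_bochner_integral_mult_right[OF this, of c] show ?thesis by simp
  qed
  have eq: "indicator unit_square z *\<^sub>R sampled_kernel k U X z = sampled_kernel k U X z" for z
  proof (cases "z \<in> unit_square")
    case False
    then have "indicator (step k i \<times> step k j) z = (0::real)" if "i \<in> {1..k}" "j \<in> {1..k}" for i j
      using step_times_step(2)[OF that] by (auto simp: indicator_def)
    then have "sampled_kernel k U X z = 0" unfolding sampled_kernel_def by (intro sum.neutral ballI) simp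
    then show ?thesis by simp
  qed simp
  have "has_bochner_integral lebesgue (sampled_kernel k U X)
     (\<Sum>i\<in>{1..k}. \<Sum>j\<in>{1..k}. (if i \<noteq> j then U (X i, X j) else 0) / (real k)\<^sup>2)"
    unfolding sampled_kernel_def by (intro has_bochner_integral_sum 1)
  then show "set_integrable lebesgue unit_square (sampled_kernel k U X)"
    and "(LINT z:unit_square|lebesgue. sampled_kernel k U X z) =
      (\<Sum>i\<in>{1..k}. \<Sum>j\<in>{1..k}. if i \<noteq> j then U (X i, X j) else 0) / (real k)\<^sup>2"
    unfolding set_integrable_def set_lebesgue_integral_def eq has_bochner_integral_iff
    by (simp_all add: sum_divide_distrib)
qed

lemma set_integrable_unit_square_const: "set_integrable lebesgue unit_square (\<lambda>_. c :: real)"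
  using lmeasurable_unit_square
  by (auto simp: set_integrable_def fmeasurable_def less_top[symmetric])

lemma set_integral_unit_square_const: "(LINT z:unit_square|lebesgue. c :: real) = c"
proof -
  have "unit_square = cbox (0, 0) (1, 1)" by (simp add: cbox_Pair_eq)
  then have "measure lebesgue unit_square = 1" by (simp add: content_Pair)
  then show ?thesis using lmeasurable_unit_square by (simp add: set_lebesgue_integral_def)
qed

lemma sum_off_diagonal_const:
  "(\<Sum>i\<in>{1..k}. \<Sum>j\<in>{1..k}. if i \<noteq> j then c else (0::real)) = c * (real k * (real k - 1))"
proof -
  have "(\<Sum>j\<in>{1..k}. if i \<noteq> j then c else 0) = c * (real k - 1)" if "i \<in> {1..k}" for i
  proof -
    have "(\<Sum>j\<in>{1..k}. if i \<noteq> j then c else 0) = (\<Sum>j\<in>{1..k}. c - (if i = j then c else 0))"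
      by (rule sum.cong) auto
    also have "\<dots> = real k * c - c" using that by (simp add: sum_subtractf)
    finally show ?thesis by (simp add: algebra_simps)
  qed
  then show ?thesis by simp
qed

text \<open>Sorting puts the value U(Y_i, Y_j) on block (i, j). Off the diagonal, the triangle
  inequality through W(x, y) and W(Y_i, Y_j) produces the first three terms; integrating the last
  difference over the blocks gives the double sum divided by k^2. On the diagonal blocks, of total
  area 1/k, only \<open>\<bar>U\<bar> \<le> \<bar>U - W\<bar> + B\<close> is available, whence
  B/k.\<close>

lemma cut_dist_sampled_kernel_le:
  assumes U: "set_integrable lebesgue unit_square U"
    and W: "set_integrable lebesgue unit_square W"
    and B: "\<And>z. z \<in> unit_square \<Longrightarrow> \<bar>W z\<bar> \<le> B"
    and modulus: "\<And>a b. a \<in> unit_square \<Longrightarrow> b \<in> unit_square \<Longrightarrow> \<bar>fst a - fst b\<bar> \<le> 3 / real N \<Longrightarrow>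
      \<bar>snd a - snd b\<bar> \<le> 3 / real N \<Longrightarrow> \<bar>W a - W b\<bar> \<le> \<epsilon>"
    and X: "\<And>i. i \<in> {1..k} \<Longrightarrow> X i \<in> {0..1}"
    and N: "0 < N" "N \<le> k"
    and cdf: "\<And>m. m \<le> N \<Longrightarrow>
      \<bar>real (card {i \<in> {1..k}. X i \<le> real m / real N}) / real k - real m / real N\<bar> \<le> 1 / real N"
  shows "cut_dist U (sampled_kernel k U X) \<le> (LINT z:unit_square|lebesgue. \<bar>U z - W z\<bar>) + \<epsilon> +
    (\<Sum>i\<in>{1..k}. \<Sum>j\<in>{1..k}. if i \<noteq> j then \<bar>U (X i, X j) - W (X i, X j)\<bar> else 0) / (real k)\<^sup>2 + B / real k"
proof -
  have k: "k > 0" using N by simp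
  obtain \<sigma> where \<sigma>: "bij_betw \<sigma> {1..k} {1..k}"
    and mono: "\<And>i j. 1 \<le> i \<Longrightarrow> i \<le> j \<Longrightarrow> j \<le> k \<Longrightarrow> X (\<sigma> i) \<le> X (\<sigma> j)"
    by (rule ex_sorting_permutation[of k X]) blast
  note \<sigma>_mem = bij_betwE[OF \<sigma>, rule_format]
  let ?\<psi> = "block_permutation k \<sigma>" and ?V = "sampled_kernel k U X"
  define Y where "Y = X \<circ> \<sigma>"
  have Y: "Y i \<in> {0..1}" if "i \<in> {1..k}" for i using X \<sigma>_mem[OF that] by (simp add: Y_def)
  have card_eq: "card {i \<in> {1..k}. Y i \<le> t} = card {i \<in> {1..k}. X i \<le> t}" for t
  proof (rule bij_betw_same_card[of \<sigma>])
    have "\<sigma> ` {i \<in> {1..k}. Y i \<le> t} = {i \<in> \<sigma> ` {1..k}. X i \<le> t}" by (auto simp: Y_def)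
    then show "bij_betw \<sigma> {i \<in> {1..k}. Y i \<le> t} {i \<in> {1..k}. X i \<le> t}"
      using \<sigma> unfolding bij_betw_def by (auto intro: inj_on_subset)
  qed
  have close: "\<bar>Y i - x\<bar> \<le> 3 / real N" if "i \<in> {1..k}" "x \<in> step k i" for i x
    by (rule sorted_sample_close[OF _ Y N _ that]) (use mono cdf card_eq in \<open>auto simp: Y_def\<close>)
  \<comment> \<open>\<open>D\<close> is lowered by \<open>B\<close> and \<open>B\<close> is added back on the whole square, so that in \<open>G\<close> the constant \<open>B\<close>
    survives exactly on the diagonal blocks and the null set not covered by the steps.\<close>
  define D where "D = (\<lambda>z. \<bar>U z - W z\<bar> - B)"
  define G where "G z = \<bar>U z - W z\<bar> + \<epsilon> + (sampled_kernel k D Y z + B)" for z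
  have \<epsilon>: "0 \<le> \<epsilon>" using modulus[of "(0,0)" "(0,0)"] by simp
  have off_step: "sampled_kernel k F Z (x, y) = 0"
    if "x \<notin> (\<Union>i\<in>{1..k}. step k i) \<or> y \<notin> (\<Union>i\<in>{1..k}. step k i)" for F Z x y
    using that unfolding sampled_kernel_def by (intro sum.neutral ballI) (auto simp: indicator_def)
  have bound: "\<bar>case z of (x, y) \<Rightarrow> U (x, y) - ?V (?\<psi> x, ?\<psi> y)\<bar> \<le> G z" if z: "z \<in> unit_square" for z
  proof -
    obtain x y where xy: "z = (x, y)" "x \<in> {0..1}" "y \<in> {0..1}" using z by blast
    have zero: "\<bar>U z - ?V (?\<psi> x, ?\<psi> y)\<bar> \<le> G z"
      if "?V (?\<psi> x, ?\<psi> y) = 0" "sampled_kernel k D Y z = 0"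
    proof -
      have "\<bar>U z\<bar> \<le> \<bar>U z - W z\<bar> + B" using B[OF z] by linarith
      with that \<epsilon> show ?thesis unfolding G_def by simp
    qed
    have "\<bar>U z - ?V (?\<psi> x, ?\<psi> y)\<bar> \<le> G z"
    proof (cases "x = 1 \<or> y = 1")
      case True
      have "1 \<notin> (\<Union>i\<in>{1..k}. step k i)" using step_subset_Ico[of _ k] by fastforce
      then show ?thesis
        using True block_permutation_1[OF k, of \<sigma>]
        by (intro zero) (auto simp: xy intro!: off_step)
    next
      case False
      with xy obtain i j where i: "i \<in> {1..k}" "x \<in> step k i" and j: "j \<in> {1..k}" "y \<in> step k j"
        using ex_step[OF k] by (metis atLeastAtMost_iff less_eq_real_def)
      \<comment> \<open>The map sends step \<open>i\<close> to step \<open>\<sigma> i\<close>, which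
        carries the sample point X (\<sigma> i) = Y i.\<close>
      have V: "?V (?\<psi> x, ?\<psi> y) = (if \<sigma> i \<noteq> \<sigma> j then U (Y i, Y j) else 0)"
        using sampled_kernel_on_step[OF \<sigma>_mem[OF i(1)] \<sigma>_mem[OF j(1)]
            block_permutation_step(2)[OF i, of \<sigma>] block_permutation_step(2)[OF j, of \<sigma>]] by (simp add: Y_def)
      have D: "sampled_kernel k D Y z = (if i \<noteq> j then D (Y i, Y j) else 0)"
        unfolding xy by (rule sampled_kernel_on_step[OF i(1) j(1) i(2) j(2)])
      show ?thesis
      proof (cases "i = j")
        case True
        then show ?thesis using V D by (intro zero) simp_all
      next
        case False
        then have "\<sigma> i \<noteq> \<sigma> j" using \<sigma> i j unfolding bij_betw_def inj_on_def by blast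
        moreover have "\<bar>W z - W (Y i, Y j)\<bar> \<le> \<epsilon>"
          using close[OF i] close[OF j] Y[OF i(1)] Y[OF j(1)] z
          by (intro modulus) (auto simp: xy abs_minus_commute)
        ultimately show ?thesis using False V D unfolding G_def D_def by simp
      qed
    qed
    then show ?thesis by (simp add: xy)
  qed
  have UW: "set_integrable lebesgue unit_square (\<lambda>z. \<bar>U z - W z\<bar>)"
    using U W by (intro set_integrable_abs set_integral_diff)
  note const = set_integrable_unit_square_const
  note sk = sampled_kernel_integrable[of k D Y]
  have "set_integrable lebesgue unit_square G"
    unfolding G_def by (intro set_integral_add UW const sk)
  note cn = cut_norm_bounds(2)[OF this bound]
  have "cut_dist U ?V \<le> cut_norm (\<lambda>(x, y). U (x, y) - ?V (?\<psi> x, ?\<psi> y))"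
    by (rule cut_dist_le[OF U sampled_kernel_bounded block_permutation_mem[OF k \<sigma>]])
  also have "\<dots> \<le> (LINT z:unit_square|lebesgue. G z)"
    by (rule cn)
  also have "\<dots> = (LINT z:unit_square|lebesgue. \<bar>U z - W z\<bar>) + \<epsilon> +
      ((\<Sum>i\<in>{1..k}. \<Sum>j\<in>{1..k}. if i \<noteq> j then D (Y i, Y j) else 0) / (real k)\<^sup>2 + B)"
    unfolding G_def
    by (simp add: set_integral_add UW const sk set_integral_unit_square_const sampled_kernel_integral(2))
  \<comment> \<open>The sum runs over all ordered pairs of distinct indices, a set invariant under
    the permutation. Undoing it, first in the column and then in the row index, restores the
    unsorted sample.\<close>
  also have "(\<Sum>i\<in>{1..k}. \<Sum>j\<in>{1..k}. if i \<noteq> j then D (Y i, Y j) else 0) =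
      (\<Sum>i\<in>{1..k}. \<Sum>j\<in>{1..k}. if \<sigma> i \<noteq> \<sigma> j then D (X (\<sigma> i), X (\<sigma> j)) else 0)"
    using inj_on_eq_iff[OF bij_betw_imp_inj_on[OF \<sigma>]] unfolding Y_def by (intro sum.cong refl) simp
  also have "\<dots> = (\<Sum>i\<in>{1..k}. \<Sum>j\<in>{1..k}. if \<sigma> i \<noteq> j then D (X (\<sigma> i), X j) else 0)"
    by (intro sum.cong refl sum.reindex_bij_betw[OF \<sigma>, where g = "\<lambda>j. if \<sigma> i \<noteq> j then D (X (\<sigma> i), X j) else 0" for i])
  also have "\<dots> = (\<Sum>i\<in>{1..k}. \<Sum>j\<in>{1..k}. if i \<noteq> j then D (X i, X j) else 0)"
    by (rule sum.reindex_bij_betw[OF \<sigma>, of "\<lambda>i. \<Sum>j\<in>{1..k}. if i \<noteq> j then D (X i, X j) else 0"])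
  also have "\<dots> = (\<Sum>i\<in>{1..k}. \<Sum>j\<in>{1..k}. if i \<noteq> j then \<bar>U (X i, X j) - W (X i, X j)\<bar> else 0) -
      (\<Sum>i\<in>{1..k}. \<Sum>j\<in>{1..k}. if i \<noteq> j then B else 0)"
    unfolding sum_subtractf[symmetric] D_def by (intro sum.cong refl) auto
  \<comment> \<open>The subtracted constants cover k(k-1) of the k^2 blocks, which leaves B -
    B(k-1)/k = B/k.\<close>
  also have "\<dots> / (real k)\<^sup>2 + B =
    (\<Sum>i\<in>{1..k}. \<Sum>j\<in>{1..k}. if i \<noteq> j then \<bar>U (X i, X j) - W (X i, X j)\<bar> else 0) / (real k)\<^sup>2 + B / real k"
    unfolding sum_off_diagonal_const using k by (simp add: field_simps power2_eq_square)
  finally show ?thesis by simp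
qed

section \<open>U-statistics of independent samples\<close>

locale iid_sample = prob_space M + Q: prob_space Q
  for M :: "'a measure" and Q :: "'b measure" +
  fixes X :: "nat \<Rightarrow> 'a \<Rightarrow> 'b" and k :: nat
  assumes indep: "indep_vars (\<lambda>_. Q) X {1..k}"
    and distr_X: "i \<in> {1..k} \<Longrightarrow> distr M Q (X i) = Q"
begin

lemma rv [measurable]: "i \<in> {1..k} \<Longrightarrow> X i \<in> M \<rightarrow>\<^sub>M Q"
  using indep unfolding indep_vars_def by blast

lemma rv_pair:
  assumes "i \<in> {1..k}" "j \<in> {1..k}"
  shows "(\<lambda>\<omega>. (X i \<omega>, X j \<omega>)) \<in> M \<rightarrow>\<^sub>M Q \<Otimes>\<^sub>M Q"
  using rv[OF assms(1)] rv[OF assms(2)] by (rule measurable_Pair)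

lemma rv_pair_compose:
  assumes "h \<in> borel_measurable (Q \<Otimes>\<^sub>M Q)" "i \<in> {1..k}" "j \<in> {1..k}"
  shows "(\<lambda>\<omega>. h (X i \<omega>, X j \<omega>)) \<in> borel_measurable M"
  using measurable_compose[OF rv_pair[OF assms(2,3)] assms(1)] .

lemma distr_pair:
  assumes ij: "i \<in> {1..k}" "j \<in> {1..k}" "i \<noteq> j"
  shows "distr M (Q \<Otimes>\<^sub>M Q) (\<lambda>\<omega>. (X i \<omega>, X j \<omega>)) = Q \<Otimes>\<^sub>M Q"
proof -
  let ?n = "\<lambda>b. if b then i else j"
  \<comment> \<open>Independence of two variables is by definition independence of a family indexed
    by the booleans, so the indices are first grouped into the blocks {i} and {j}.\<close>
  have "indep_vars (\<lambda>b. PiM {?n b} (\<lambda>_. Q)) (\<lambda>b \<omega>. restrict (\<lambda>i. X i \<omega>) {?n b}) UNIV"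
    by (rule indep_vars_restrict[OF indep]) (use ij in \<open>auto simp: disjoint_family_on_def\<close>)
  then have "indep_vars (\<lambda>_. Q) (\<lambda>b \<omega>. restrict (\<lambda>i. X i \<omega>) {?n b} (?n b)) UNIV"
    by (rule indep_vars_compose2[where Y = "\<lambda>b f. f (?n b)"]) (rule measurable_component_singleton, simp)
  moreover have "(\<lambda>b \<omega>. restrict (\<lambda>i. X i \<omega>) {?n b} (?n b)) = case_bool (X i) (X j)"
    by (auto simp: fun_eq_iff split: bool.split)
  moreover have "(\<lambda>_. Q) = case_bool Q Q" by (auto simp: fun_eq_iff split: bool.split)
  ultimately have "indep_vars (case_bool Q Q) (case_bool (X i) (X j)) UNIV" by simp
  then have "indep_var Q (X i) Q (X j)" unfolding indep_var_def .
  then show ?thesis using distr_X ij by (simp add: indep_var_distribution_eq)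
qed

lemma expectation_pair:
  fixes h :: "'b \<times> 'b \<Rightarrow> real"
  assumes h: "h \<in> borel_measurable (Q \<Otimes>\<^sub>M Q)" and ij: "i \<in> {1..k}" "j \<in> {1..k}" "i \<noteq> j"
  shows "expectation (\<lambda>\<omega>. h (X i \<omega>, X j \<omega>)) = (LINT z|(Q \<Otimes>\<^sub>M Q). h z)"
    and "integrable M (\<lambda>\<omega>. h (X i \<omega>, X j \<omega>)) \<longleftrightarrow> integrable (Q \<Otimes>\<^sub>M Q) h"
  using integral_distr[OF rv_pair[OF ij(1,2)] h] integrable_distr_eq[OF rv_pair[OF ij(1,2)] h]
  unfolding distr_pair[OF ij] by simp_all

section \<open>Hoeffding bounds for sums over pairs\<close>

text \<open>Disjoint pairs use disjoint groups of the independent variables, and functions of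
  disjoint groups are independent.\<close>

lemma indep_vars_matching:
  fixes h :: "'b \<times> 'b \<Rightarrow> real"
  assumes h: "h \<in> borel_measurable (Q \<Otimes>\<^sub>M Q)" and A: "A \<subseteq> {1..k} \<times> {1..k}"
    and disj: "\<And>p q. p \<in> A \<Longrightarrow> q \<in> A \<Longrightarrow> p \<noteq> q \<Longrightarrow> {fst p, snd p} \<inter> {fst q, snd q} = {}"
  shows "indep_vars (\<lambda>_. borel) (\<lambda>p \<omega>. h (X (fst p) \<omega>, X (snd p) \<omega>)) A"
proof -
  have "indep_vars (\<lambda>p. PiM {fst p, snd p} (\<lambda>_. Q)) (\<lambda>p \<omega>. restrict (\<lambda>i. X i \<omega>) {fst p, snd p}) A"
    by (rule indep_vars_restrict[OF indep]) (use A disj in \<open>auto simp: disjoint_family_on_def\<close>)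
  then have "indep_vars (\<lambda>_. borel)
      (\<lambda>p \<omega>. h (restrict (\<lambda>i. X i \<omega>) {fst p, snd p} (fst p), restrict (\<lambda>i. X i \<omega>) {fst p, snd p} (snd p))) A"
  proof (rule indep_vars_compose2[where Y = "\<lambda>p f. h (f (fst p), f (snd p))"])
    fix p
    have "(\<lambda>f. (f (fst p), f (snd p))) \<in> PiM {fst p, snd p} (\<lambda>_. Q) \<rightarrow>\<^sub>M Q \<Otimes>\<^sub>M Q"
      by (intro measurable_Pair measurable_component_singleton) auto
    from measurable_compose[OF this h]
    show "(\<lambda>f. h (f (fst p), f (snd p))) \<in> borel_measurable (PiM {fst p, snd p} (\<lambda>_. Q))" .
  qed
  then show ?thesis by simp
qed

text \<open>The threshold is scaled by \<open>k\<close> instead of \<open>card A\<close> to be the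
  same for all matchings. This only helps: \<open>card A \<le> k\<close> makes the required excess
  over the mean at least \<open>k * \<epsilon>\<close>, and fewer summands improve the
  exponent.\<close>

lemma matching_Hoeffding:
  fixes h :: "'b \<times> 'b \<Rightarrow> real"
  assumes h: "h \<in> borel_measurable (Q \<Otimes>\<^sub>M Q)" and A: "A \<subseteq> {1..k} \<times> {1..k}"
    and disj: "\<And>p q. p \<in> A \<Longrightarrow> q \<in> A \<Longrightarrow> p \<noteq> q \<Longrightarrow> {fst p, snd p} \<inter> {fst q, snd q} = {}"
    and ne: "\<And>p. p \<in> A \<Longrightarrow> fst p \<noteq> snd p"
    and bnd: "\<And>z. 0 \<le> h z" "\<And>z. h z \<le> t" and t: "t > 0" and \<epsilon>: "\<epsilon> > 0" and k: "k > 0"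
  shows "prob {\<omega> \<in> space M. (\<Sum>p\<in>A. h (X (fst p) \<omega>, X (snd p) \<omega>)) \<ge> real k * ((LINT z|(Q \<Otimes>\<^sub>M Q). h z) + \<epsilon>)}
    \<le> exp (- 2 * real k * \<epsilon>\<^sup>2 / t\<^sup>2)"
proof (cases "A = {}")
  case True
  have "0 \<le> (LINT z|(Q \<Otimes>\<^sub>M Q). h z)" using bnd by simp
  then have "real k * ((LINT z|(Q \<Otimes>\<^sub>M Q). h z) + \<epsilon>) > 0" using k \<epsilon> by (intro mult_pos_pos) auto
  then have "{\<omega> \<in> space M. (\<Sum>p\<in>A. h (X (fst p) \<omega>, X (snd p) \<omega>)) \<ge> real k * ((LINT z|(Q \<Otimes>\<^sub>M Q). h z) + \<epsilon>)} = {}"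
    using True by auto
  then show ?thesis by (simp only: measure_empty exp_ge_zero)
next
  case False
  have fin: "finite A" by (rule finite_subset[OF A]) simp
  let ?\<mu> = "LINT z|(Q \<Otimes>\<^sub>M Q). h z"
  let ?Z = "\<lambda>p \<omega>. h (X (fst p) \<omega>, X (snd p) \<omega>)"
  have \<mu>0: "0 \<le> ?\<mu>" using bnd by simp
  \<comment> \<open>Disjoint pairs have distinct first entries, so there are at most
    \<open>k\<close> of them.\<close>
  have inj: "inj_on fst A" using disj unfolding inj_on_def by blast
  have "card A = card (fst ` A)" using inj by (simp add: card_image)
  also have "\<dots> \<le> card {1..k}" by (rule card_mono) (use A in auto)
  finally have cA: "card A \<le> k" by simp
  have cA0: "card A > 0" using False fin by (simp add: card_gt_0_iff)
  have \<mu>: "(\<Sum>p\<in>A. expectation (?Z p)) = real (card A) * ?\<mu>"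
  proof -
    have "expectation (?Z p) = ?\<mu>" if "p \<in> A" for p
      using expectation_pair(1)[OF h, of "fst p" "snd p"] A ne[OF that] that by auto
    then show ?thesis by simp
  qed
  interpret H: Hoeffding_ineq M A ?Z "\<lambda>_. 0" "\<lambda>_. t" "real (card A) * ?\<mu>"
  proof unfold_locales
    show "indep_vars (\<lambda>_. borel) ?Z A" by (rule indep_vars_matching[OF h A disj])
  qed (use fin bnd \<mu> in auto)
  have sub: "{\<omega> \<in> space M. (\<Sum>p\<in>A. ?Z p \<omega>) \<ge> real k * (?\<mu> + \<epsilon>)} \<subseteq>
        {\<omega> \<in> space M. (\<Sum>p\<in>A. ?Z p \<omega>) \<ge> real (card A) * ?\<mu> + real k * \<epsilon>}"
  proof -
    have "real (card A) * ?\<mu> + real k * \<epsilon> \<le> real k * (?\<mu> + \<epsilon>)"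
      using mult_right_mono[of "real (card A)" "real k" ?\<mu>] cA \<mu>0 by (simp add: algebra_simps)
    then show ?thesis by auto
  qed
  have "prob {\<omega> \<in> space M. (\<Sum>p\<in>A. ?Z p \<omega>) \<ge> real k * (?\<mu> + \<epsilon>)} \<le>
      prob {\<omega> \<in> space M. (\<Sum>p\<in>A. ?Z p \<omega>) \<ge> real (card A) * ?\<mu> + real k * \<epsilon>}"
  proof (rule finite_measure_mono[OF sub])
    have "(\<lambda>\<omega>. \<Sum>p\<in>A. ?Z p \<omega>) \<in> borel_measurable M"
      by (intro borel_measurable_sum rv_pair_compose[OF h]) (use A in auto)
    then show "{\<omega> \<in> space M. (\<Sum>p\<in>A. ?Z p \<omega>) \<ge> real (card A) * ?\<mu> + real k * \<epsilon>} \<in> sets M" by measurable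
  qed
  also have "\<dots> \<le> exp (- 2 * (real k * \<epsilon>)\<^sup>2 / (\<Sum>p\<in>A. (t - 0)\<^sup>2))"
    by (rule H.Hoeffding_ineq_ge) (use \<epsilon> t cA0 in auto)
  also have "\<dots> \<le> exp (- 2 * real k * \<epsilon>\<^sup>2 / t\<^sup>2)"
  proof -
    have "real k * \<epsilon>\<^sup>2 / t\<^sup>2 = (real k * \<epsilon>)\<^sup>2 / (real k * t\<^sup>2)"
      using k by (simp add: power2_eq_square field_simps)
    also have "\<dots> \<le> (real k * \<epsilon>)\<^sup>2 / (real (card A) * t\<^sup>2)"
      using cA cA0 t by (intro divide_left_mono mult_right_mono) auto
    finally show ?thesis by simp
  qed
  finally show ?thesis .
qed

text \<open>The pairs \<open>i < j\<close> are split according to \<open>i + j\<close> modulo \<open>k\<close>. Within a class they are disjoint,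
  so that Hoeffding's inequality applies to each class.\<close>

lemma bounded_U_statistic:
  fixes h :: "'b \<times> 'b \<Rightarrow> real"
  assumes h: "h \<in> borel_measurable (Q \<Otimes>\<^sub>M Q)"
    and bnd: "\<And>z. 0 \<le> h z" "\<And>z. h z \<le> t" and t: "t > 0" and \<epsilon>: "\<epsilon> > 0" and k: "k > 0"
  shows "prob {\<omega> \<in> space M. (\<Sum>p | p \<in> {1..k} \<times> {1..k} \<and> fst p < snd p. h (X (fst p) \<omega>, X (snd p) \<omega>))
      \<ge> (real k)\<^sup>2 * ((LINT z|(Q \<Otimes>\<^sub>M Q). h z) + \<epsilon>)} \<le> real k * exp (- 2 * real k * \<epsilon>\<^sup>2 / t\<^sup>2)"
proof -
  define A where "A c = {p \<in> {1..k} \<times> {1..k}. fst p < snd p \<and> (fst p + snd p) mod k = c}" for c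
  let ?b = "real k * ((LINT z|(Q \<Otimes>\<^sub>M Q). h z) + \<epsilon>)"
  let ?Z = "\<lambda>p \<omega>. h (X (fst p) \<omega>, X (snd p) \<omega>)"
  have fin: "finite (A c)" for c unfolding A_def by simp
  have eq: "{p. p \<in> {1..k} \<times> {1..k} \<and> fst p < snd p} = (\<Union>c<k. A c)"
    unfolding A_def using k by auto
  \<comment> \<open>The set {1..k} represents each residue once. Hence in a fixed class an index has
    only one possible partner.\<close>
  have mod_eq: "a = b" if "a \<in> {1..k}" "b \<in> {1..k}" "(a + i) mod k = (b + i) mod k" for a b i :: nat
  proof -
    have "a mod k = b mod k" using that(3) 
    proof -
      have "int k dvd (int a + int i) - (int b + int i)"
        using that(3) by (metis mod_eq_dvd_iff of_nat_add zmod_int)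
      then have "int a mod int k = int b mod int k" by (simp add: mod_eq_dvd_iff)
      then show ?thesis by (metis nat_int_comparison(1) zmod_int)
    qed
    then show ?thesis using that(1,2) by (cases "a = k"; cases "b = k") auto
  qed
  have disj: "{fst p, snd p} \<inter> {fst q, snd q} = {}" if pq: "p \<in> A c" "q \<in> A c" "p \<noteq> q" for p q c
  proof -
    obtain i j i' j' where p: "p = (i, j)" and q: "q = (i', j')" by (cases p, cases q)
    have r: "i \<in> {1..k}" "j \<in> {1..k}" "i' \<in> {1..k}" "j' \<in> {1..k}" "i < j" "i' < j'"
      "(i + j) mod k = c" "(i' + j') mod k = c" "\<not> (i = i' \<and> j = j')"
      using pq unfolding p q A_def by auto
    have "i \<noteq> i'" using mod_eq[of j j' i] r by (auto simp: add.commute)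
    moreover have "j \<noteq> j'" using mod_eq[of i i' j] r by auto
    \<comment> \<open>If i = j', the partners agree as well, j = i', and then i < j = i' < j' = i.
      The next case is symmetric.\<close>
    moreover have "i \<noteq> j'" using mod_eq[of j i' i] r by (auto simp: add.commute)
    moreover have "j \<noteq> i'" using mod_eq[of i j' j] r by (auto simp: add.commute)
    ultimately show ?thesis unfolding p q by auto
  qed
  have meas: "{\<omega> \<in> space M. (\<Sum>p\<in>A c. ?Z p \<omega>) \<ge> ?b} \<in> events" for c
  proof -
    have "(\<lambda>\<omega>. \<Sum>p\<in>A c. ?Z p \<omega>) \<in> borel_measurable M"
      by (intro borel_measurable_sum rv_pair_compose[OF h]) (auto simp: A_def)
    then show ?thesis by measurable
  qed
  have "prob {\<omega> \<in> space M. (\<Sum>p | p \<in> {1..k} \<times> {1..k} \<and> fst p < snd p. ?Z p \<omega>)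
      \<ge> (real k)\<^sup>2 * ((LINT z|(Q \<Otimes>\<^sub>M Q). h z) + \<epsilon>)} \<le>
    prob (\<Union>c<k. {\<omega> \<in> space M. (\<Sum>p\<in>A c. ?Z p \<omega>) \<ge> ?b})"
  proof (rule finite_measure_mono)
    show "(\<Union>c<k. {\<omega> \<in> space M. (\<Sum>p\<in>A c. ?Z p \<omega>) \<ge> ?b}) \<in> events"
      using meas by (intro sets.finite_UN) auto
    show "{\<omega> \<in> space M. (\<Sum>p | p \<in> {1..k} \<times> {1..k} \<and> fst p < snd p. ?Z p \<omega>)
        \<ge> (real k)\<^sup>2 * ((LINT z|(Q \<Otimes>\<^sub>M Q). h z) + \<epsilon>)} \<subseteq>
      (\<Union>c<k. {\<omega> \<in> space M. (\<Sum>p\<in>A c. ?Z p \<omega>) \<ge> ?b})"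
    proof (rule subsetI, rule ccontr)
      fix \<omega> assume w: "\<omega> \<in> {\<omega> \<in> space M. (\<Sum>p | p \<in> {1..k} \<times> {1..k} \<and> fst p < snd p. ?Z p \<omega>)
        \<ge> (real k)\<^sup>2 * ((LINT z|(Q \<Otimes>\<^sub>M Q). h z) + \<epsilon>)}"
        and n: "\<omega> \<notin> (\<Union>c<k. {\<omega> \<in> space M. (\<Sum>p\<in>A c. ?Z p \<omega>) \<ge> ?b})"
      have "(\<Sum>p | p \<in> {1..k} \<times> {1..k} \<and> fst p < snd p. ?Z p \<omega>) = (\<Sum>c<k. \<Sum>p\<in>A c. ?Z p \<omega>)"
        unfolding eq by (rule sum.UNION_disjoint) (use fin in \<open>auto simp: A_def\<close>)
      \<comment> \<open>If no class reaches \<open>?b\<close>, the total stays below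
        \<open>k * ?b\<close>. Since there are fewer than half of k^2 pairs, this threshold exceeds
        twice the mean of the sum, a loss that a small mean can afford.\<close>
      also have "\<dots> < (\<Sum>c<k. ?b)"
        using n w k by (intro sum_strict_mono) (auto simp: not_le)
      also have "\<dots> = (real k)\<^sup>2 * ((LINT z|(Q \<Otimes>\<^sub>M Q). h z) + \<epsilon>)" by (simp add: power2_eq_square)
      finally show False using w by simp
    qed
  qed
  also have "\<dots> \<le> (\<Sum>c<k. prob {\<omega> \<in> space M. (\<Sum>p\<in>A c. ?Z p \<omega>) \<ge> ?b})"
    by (rule measure_UNION_le) (use meas in auto)
  also have "\<dots> \<le> (\<Sum>c<k. exp (- 2 * real k * \<epsilon>\<^sup>2 / t\<^sup>2))"
    by (intro sum_mono matching_Hoeffding[OF h _ disj _ bnd t \<epsilon> k]) (auto simp: A_def)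
  finally show ?thesis by simp
qed

text \<open>The part of \<open>g\<close> below the truncation level \<open>t\<close> is handled by Hoeffding's inequality, the part
  above it by Markov's inequality and \<open>r \<le> g\<^sup>4 / t\<^sup>3\<close>.\<close>

lemma U_statistic_upper_tail:
  fixes g :: "'b \<times> 'b \<Rightarrow> real"
  assumes g: "g \<in> borel_measurable (Q \<Otimes>\<^sub>M Q)" and g0: "\<And>z. 0 \<le> g z"
    and int: "integrable (Q \<Otimes>\<^sub>M Q) g" and int4: "integrable (Q \<Otimes>\<^sub>M Q) (\<lambda>z. g z ^ 4)"
    and t: "t > 0" and \<epsilon>: "\<epsilon> > 0" and k: "k > 0"
  shows "prob {\<omega> \<in> space M. (\<Sum>p | p \<in> {1..k} \<times> {1..k} \<and> fst p < snd p. g (X (fst p) \<omega>, X (snd p) \<omega>))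
      \<ge> (real k)\<^sup>2 * ((LINT z|(Q \<Otimes>\<^sub>M Q). g z) + 2 * \<epsilon>)}
    \<le> real k * exp (- 2 * real k * \<epsilon>\<^sup>2 / t\<^sup>2) + (LINT z|(Q \<Otimes>\<^sub>M Q). g z ^ 4) / (t ^ 3 * \<epsilon>)"
proof -
  let ?P = "{p. p \<in> {1..k} \<times> {1..k} \<and> fst p < snd p}"
  define h where "h z = (if g z \<le> t then g z else 0)" for z
  define r where "r z = (if g z \<le> t then 0 else g z)" for z
  have hm: "h \<in> borel_measurable (Q \<Otimes>\<^sub>M Q)" and rm: "r \<in> borel_measurable (Q \<Otimes>\<^sub>M Q)"
    unfolding h_def r_def using g by measurable
  have grh: "g z = h z + r z" and hg: "h z \<le> g z" and h0: "0 \<le> h z" and ht: "h z \<le> t" and r0: "0 \<le> r z" for z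
    using g0[of z] t by (auto simp: h_def r_def)
  have rb: "r z \<le> g z ^ 4 / t ^ 3" for z
  proof (cases "g z \<le> t")
    case True
    then show ?thesis using g0 t by (simp add: r_def)
  next
    case False
    then have "t ^ 3 \<le> g z ^ 3" using t by (intro power_mono) auto
    then have "g z * t ^ 3 \<le> g z * g z ^ 3" using g0 by (rule mult_left_mono)
    then show ?thesis using False t by (simp add: r_def field_simps power4_eq_xxxx power3_eq_cube)
  qed
  have ih: "integrable (Q \<Otimes>\<^sub>M Q) h"
    by (rule Bochner_Integration.integrable_bound[OF int hm]) (use h0 hg g0 in auto)
  have ir: "integrable (Q \<Otimes>\<^sub>M Q) r"
    using Bochner_Integration.integrable_diff[OF int ih] grh by simp
  have \<mu>h: "(LINT z|(Q \<Otimes>\<^sub>M Q). h z) \<le> (LINT z|(Q \<Otimes>\<^sub>M Q). g z)"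
    by (rule integral_mono[OF ih int]) (rule hg)
  have \<mu>r: "(LINT z|(Q \<Otimes>\<^sub>M Q). r z) \<le> (LINT z|(Q \<Otimes>\<^sub>M Q). g z ^ 4) / t ^ 3"
    using integral_mono[OF ir, of "\<lambda>z. g z ^ 4 / t ^ 3"] rb int4 by simp
  let ?S = "\<lambda>f \<omega>. \<Sum>p\<in>?P. f (X (fst p) \<omega>, X (snd p) \<omega>)"
  have meas: "?S f \<in> borel_measurable M" if "f \<in> borel_measurable (Q \<Otimes>\<^sub>M Q)" for f :: "'b \<times> 'b \<Rightarrow> real"
    by (intro borel_measurable_sum rv_pair_compose[OF that]) auto
  let ?E1 = "{\<omega> \<in> space M. ?S h \<omega> \<ge> (real k)\<^sup>2 * ((LINT z|(Q \<Otimes>\<^sub>M Q). h z) + \<epsilon>)}"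
  let ?E2 = "{\<omega> \<in> space M. ?S r \<omega> \<ge> (real k)\<^sup>2 * \<epsilon>}"
  have E: "?E1 \<in> events" "?E2 \<in> events" using meas[OF hm] meas[OF rm] by measurable
  have "prob {\<omega> \<in> space M. ?S g \<omega> \<ge> (real k)\<^sup>2 * ((LINT z|(Q \<Otimes>\<^sub>M Q). g z) + 2 * \<epsilon>)} \<le> prob (?E1 \<union> ?E2)"
  proof (rule finite_measure_mono)
    show "{\<omega> \<in> space M. ?S g \<omega> \<ge> (real k)\<^sup>2 * ((LINT z|(Q \<Otimes>\<^sub>M Q). g z) + 2 * \<epsilon>)} \<subseteq> ?E1 \<union> ?E2"
    proof
      fix \<omega> assume w: "\<omega> \<in> {\<omega> \<in> space M. ?S g \<omega> \<ge> (real k)\<^sup>2 * ((LINT z|(Q \<Otimes>\<^sub>M Q). g z) + 2 * \<epsilon>)}"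
      \<comment> \<open>One \<open>\<epsilon>\<close> is the deviation allowed to the truncated
        part, the other is the whole allowance of the remainder.\<close>
      have "(real k)\<^sup>2 * ((LINT z|(Q \<Otimes>\<^sub>M Q). h z) + \<epsilon>) + (real k)\<^sup>2 * \<epsilon> \<le>
          (real k)\<^sup>2 * ((LINT z|(Q \<Otimes>\<^sub>M Q). g z) + 2 * \<epsilon>)"
        using mult_left_mono[OF \<mu>h, of "(real k)\<^sup>2"] by (simp add: algebra_simps)
      also have "\<dots> \<le> ?S g \<omega>" using w by simp
      also have "\<dots> = ?S h \<omega> + ?S r \<omega>" unfolding sum.distrib[symmetric] by (subst grh) simp
      finally show "\<omega> \<in> ?E1 \<union> ?E2" using w by auto
    qed
    show "?E1 \<union> ?E2 \<in> events" using E by blast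
  qed
  also have "\<dots> \<le> prob ?E1 + prob ?E2" by (rule measure_Un_le[OF E])
  also have "prob ?E1 \<le> real k * exp (- 2 * real k * \<epsilon>\<^sup>2 / t\<^sup>2)"
    by (rule bounded_U_statistic[OF hm h0 ht t \<epsilon> k])
  also have "prob ?E2 \<le> (LINT z|(Q \<Otimes>\<^sub>M Q). g z ^ 4) / (t ^ 3 * \<epsilon>)"
  proof -
    have ip: "integrable M (\<lambda>\<omega>. r (X (fst p) \<omega>, X (snd p) \<omega>))"
      and ep: "expectation (\<lambda>\<omega>. r (X (fst p) \<omega>, X (snd p) \<omega>)) = (LINT z|(Q \<Otimes>\<^sub>M Q). r z)"
      if "p \<in> ?P" for p
      using expectation_pair[OF rm, of "fst p" "snd p"] ir that by auto
    have "prob ?E2 \<le> expectation (?S r) / ((real k)\<^sup>2 * \<epsilon>)"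
      by (rule integral_Markov_inequality_measure[of _ _ "{}"])
         (use ip r0 k \<epsilon> in \<open>auto intro!: Bochner_Integration.integrable_sum sum_nonneg AE_I2\<close>)
    \<comment> \<open>By linearity, only the laws of single pairs enter the mean of the
      remainder.\<close>
    also have "expectation (?S r) = real (card ?P) * (LINT z|(Q \<Otimes>\<^sub>M Q). r z)"
      using ip ep by (subst Bochner_Integration.integral_sum) auto
    also have "\<dots> \<le> (real k)\<^sup>2 * (LINT z|(Q \<Otimes>\<^sub>M Q). r z)"
    proof (rule mult_right_mono)
      have "card ?P \<le> card ({1..k} \<times> {1..k})" by (rule card_mono) auto
      also have "\<dots> = k\<^sup>2" by (simp add: power2_eq_square)
      finally show "real (card ?P) \<le> (real k)\<^sup>2" by (metis of_nat_le_iff of_nat_power)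
    qed (use r0 in simp)
    finally have "prob ?E2 \<le> (real k)\<^sup>2 * (LINT z|(Q \<Otimes>\<^sub>M Q). r z) / ((real k)\<^sup>2 * \<epsilon>)"
      using k \<epsilon> by (simp add: divide_right_mono)
    also have "\<dots> = (LINT z|(Q \<Otimes>\<^sub>M Q). r z) / \<epsilon>" using k by simp
    also have "\<dots> \<le> (LINT z|(Q \<Otimes>\<^sub>M Q). g z ^ 4) / t ^ 3 / \<epsilon>" using \<mu>r \<epsilon> by (intro divide_right_mono) auto
    finally show ?thesis by (simp only: divide_divide_eq_left)
  qed
  finally show ?thesis by simp
qed

text \<open>The bound is two-sided because the sorted sample has to be located from above and from
  below. It is later applied to the intervals \<open>{0..m/N}\<close>.\<close>

lemma empirical_frequency:
  assumes B: "B \<in> sets Q" and \<epsilon>: "\<epsilon> > 0" and k: "k > 0"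
  shows "{\<omega> \<in> space M. \<bar>real (card {i \<in> {1..k}. X i \<omega> \<in> B}) / real k - measure Q B\<bar> \<ge> \<epsilon>} \<in> events"
    and "prob {\<omega> \<in> space M. \<bar>real (card {i \<in> {1..k}. X i \<omega> \<in> B}) / real k - measure Q B\<bar> \<ge> \<epsilon>}
      \<le> 2 * exp (- 2 * real k * \<epsilon>\<^sup>2)"
proof -
  let ?Z = "\<lambda>i \<omega>. indicator B (X i \<omega>) :: real"
  have iB: "indicat_real B \<in> borel_measurable Q" using B by simp
  have Zm: "?Z i \<in> borel_measurable M" if "i \<in> {1..k}" for i
    using measurable_compose[OF rv[OF that] iB] .
  have e: "expectation (?Z i) = measure Q B" if "i \<in> {1..k}" for i
    
    using integral_distr[OF rv[OF that] iB] distr_X[OF that] B by simp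
  have card: "real (card {i \<in> {1..k}. X i \<omega> \<in> B}) = (\<Sum>i\<in>{1..k}. ?Z i \<omega>)" for \<omega>
    by (simp add: indicator_def sum.If_cases Int_def)
  interpret H: Hoeffding_ineq M "{1..k}" ?Z "\<lambda>_. 0" "\<lambda>_. 1" "real k * measure Q B"
  proof unfold_locales
    show "indep_vars (\<lambda>_. borel) ?Z {1..k}" by (rule indep_vars_compose2[OF indep]) (rule iB)
  qed (use e in \<open>auto simp: indicator_def\<close>)
  have eq: "{\<omega> \<in> space M. \<bar>real (card {i \<in> {1..k}. X i \<omega> \<in> B}) / real k - measure Q B\<bar> \<ge> \<epsilon>} =
    {\<omega> \<in> space M. \<bar>(\<Sum>i\<in>{1..k}. ?Z i \<omega>) - real k * measure Q B\<bar> \<ge> real k * \<epsilon>}"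
  proof -
    have "\<bar>a / real k - b\<bar> \<ge> \<epsilon> \<longleftrightarrow> \<bar>a - real k * b\<bar> \<ge> real k * \<epsilon>" for a b
    proof -
      have "a / real k - b = (a - real k * b) / real k" using k by (simp add: field_simps)
      then have "\<bar>a / real k - b\<bar> = \<bar>a - real k * b\<bar> / real k" by (simp add: abs_divide)
      then show ?thesis using k by (simp add: pos_le_divide_eq mult.commute)
    qed
    then show ?thesis unfolding card by simp
  qed
  have "(\<lambda>\<omega>. \<Sum>i\<in>{1..k}. ?Z i \<omega>) \<in> borel_measurable M" by (rule borel_measurable_sum) (rule Zm)
  then show "{\<omega> \<in> space M. \<bar>real (card {i \<in> {1..k}. X i \<omega> \<in> B}) / real k - measure Q B\<bar> \<ge> \<epsilon>} \<in> events"
    unfolding eq by measurable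
  have "prob {\<omega> \<in> space M. \<bar>(\<Sum>i\<in>{1..k}. ?Z i \<omega>) - real k * measure Q B\<bar> \<ge> real k * \<epsilon>}
      \<le> 2 * exp (- 2 * (real k * \<epsilon>)\<^sup>2 / (\<Sum>i\<in>{1..k}. (1 - 0)\<^sup>2))"
    by (rule H.Hoeffding_ineq_abs_ge) (use k \<epsilon> in auto)
  also have "(real k * \<epsilon>)\<^sup>2 / (\<Sum>i\<in>{1..k}. (1 - 0)\<^sup>2) = real k * \<epsilon>\<^sup>2"
    using k by (simp add: power2_eq_square)
  then have "2 * exp (- 2 * (real k * \<epsilon>)\<^sup>2 / (\<Sum>i\<in>{1..k}. (1 - 0)\<^sup>2)) = 2 * exp (- 2 * real k * \<epsilon>\<^sup>2)"
    by simp
  finally show "prob {\<omega> \<in> space M. \<bar>real (card {i \<in> {1..k}. X i \<omega> \<in> B}) / real k - measure Q B\<bar> \<ge> \<epsilon>}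
      \<le> 2 * exp (- 2 * real k * \<epsilon>\<^sup>2)"
    unfolding eq .
qed

end

section \<open>Uniform samples and approximation of kernels\<close>

abbreviation unif :: "real measure"
  where "unif \<equiv> restrict_space lborel {0..1}"

lemma prob_space_unif: "prob_space unif"
  by (rule prob_spaceI) (simp add: space_restrict_space emeasure_restrict_space)

text \<open>This links the law of a sampled pair to area on the square. The two sigma-algebras
  coincide because the identity is measurable in both directions; the measures agree on
  rectangles.\<close>

lemma unif_pair: "unif \<Otimes>\<^sub>M unif = restrict_space lborel unit_square"
proof (rule pair_measure_eqI)
  let ?L = "restrict_space (lborel :: (real \<times> real) measure) unit_square"
  interpret prob_space unif by (rule prob_space_unif)
  show "sigma_finite_measure unif" "sigma_finite_measure unif" by (rule sigma_finite_measure_axioms)+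
  have space: "space (unif \<Otimes>\<^sub>M unif) = space ?L"
    by (simp add: space_pair_measure space_restrict_space)
  have "(\<lambda>z. z) \<in> unif \<Otimes>\<^sub>M unif \<rightarrow>\<^sub>M lborel"
  proof -
    have "(\<lambda>z. (fst z, snd z)) \<in> unif \<Otimes>\<^sub>M unif \<rightarrow>\<^sub>M lborel \<Otimes>\<^sub>M lborel"
      by (intro measurable_Pair measurable_compose[OF measurable_fst] measurable_compose[OF measurable_snd]
          measurable_restrict_space1) auto
    then show ?thesis by (simp add: lborel_prod)
  qed
  then have 1: "(\<lambda>z. z) \<in> unif \<Otimes>\<^sub>M unif \<rightarrow>\<^sub>M ?L"
    by (intro measurable_restrict_space2) (auto simp: space_pair_measure space_restrict_space)
  have "(\<lambda>z. (fst z, snd z)) \<in> ?L \<rightarrow>\<^sub>M unif \<Otimes>\<^sub>M unif"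
  proof (intro measurable_Pair measurable_restrict_space3)
    show "fst \<in> (lborel :: (real \<times> real) measure) \<rightarrow>\<^sub>M lborel"
      "snd \<in> (lborel :: (real \<times> real) measure) \<rightarrow>\<^sub>M lborel"
      by (simp_all add: borel_measurable_continuous_onI continuous_on_fst continuous_on_snd)
  qed auto
  then have 2: "(\<lambda>z. z) \<in> ?L \<rightarrow>\<^sub>M unif \<Otimes>\<^sub>M unif" by simp
  show "sets (unif \<Otimes>\<^sub>M unif) = sets ?L"
  proof (intro equalityI subsetI)
    fix A assume A: "A \<in> sets (unif \<Otimes>\<^sub>M unif)"
    then have "A \<subseteq> space ?L" using sets.sets_into_space space by metis
    then have "(\<lambda>z. z) -` A \<inter> space ?L = A" by auto
    with measurable_sets[OF 2 A] show "A \<in> sets ?L" by simp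
  next
    fix A assume A: "A \<in> sets ?L"
    then have "A \<subseteq> space (unif \<Otimes>\<^sub>M unif)" using sets.sets_into_space space by metis
    then have "(\<lambda>z. z) -` A \<inter> space (unif \<Otimes>\<^sub>M unif) = A" by auto
    with measurable_sets[OF 1 A] show "A \<in> sets (unif \<Otimes>\<^sub>M unif)" by simp
  qed
  fix A B assume "A \<in> sets unif" "B \<in> sets unif"
  then have AB: "A \<in> sets lborel" "B \<in> sets lborel" "A \<subseteq> {0..1}" "B \<subseteq> {0..1}"
    by (auto simp: sets_restrict_space)
  have "emeasure unif A * emeasure unif B = emeasure (lborel \<Otimes>\<^sub>M lborel) (A \<times> B)"
    using AB by (simp add: emeasure_restrict_space lborel.emeasure_pair_measure_Times)
  also have "\<dots> = emeasure ?L (A \<times> B)"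
  proof -
    have "unit_square \<inter> space lborel \<in> sets lborel"
      by (simp add: borel_closed closed_Times)
    moreover have "A \<times> B \<subseteq> unit_square" using AB by blast
    ultimately show ?thesis by (simp add: emeasure_restrict_space lborel_prod)
  qed
  finally show "emeasure unif A * emeasure unif B = emeasure ?L (A \<times> B)" .
qed

lemma unit_square_borel: "unit_square \<in> sets borel"
  by (simp add: borel_closed closed_Times)

text \<open>For Borel \<open>f\<close>, passing to the completion changes neither integrability nor
  the integral, so expectations over sampled pairs become Lebesgue integrals over the
  square.\<close>

lemma unif_pair_integral:
  fixes f :: "real \<times> real \<Rightarrow> real"
  assumes f: "f \<in> borel_measurable borel"
  shows "f \<in> borel_measurable (unif \<Otimes>\<^sub>M unif)"
    and "integrable (unif \<Otimes>\<^sub>M unif) f \<longleftrightarrow> set_integrable lebesgue unit_square f"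
    and "(LINT z|(unif \<Otimes>\<^sub>M unif). f z) = (LINT z:unit_square|lebesgue. f z)"
proof -
  have m: "(\<lambda>z. indicator unit_square z *\<^sub>R f z) \<in> borel_measurable lborel"
    using f unit_square_borel by simp
  show "f \<in> borel_measurable (unif \<Otimes>\<^sub>M unif)"
    unfolding unif_pair using f by (intro measurable_restrict_space1) simp
  show "integrable (unif \<Otimes>\<^sub>M unif) f \<longleftrightarrow> set_integrable lebesgue unit_square f"
    unfolding unif_pair set_integrable_def integrable_completion[OF m]
    using unit_square_borel by (simp add: integrable_restrict_space)
  show "(LINT z|(unif \<Otimes>\<^sub>M unif). f z) = (LINT z:unit_square|lebesgue. f z)"
    unfolding unif_pair set_lebesgue_integral_def integral_completion[OF m]
    using unit_square_borel by (simp add: integral_restrict_space)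
qed

lemma AE_unif_pair:
  assumes "AE z in lborel. P z"
  shows "AE z in unif \<Otimes>\<^sub>M unif. P z"
  unfolding unif_pair using assms unit_square_borel by (auto simp: AE_restrict_space_iff elim: eventually_mono)

lemma iid_sample_uniform_random_vector:
  assumes M: "prob_space M" and k: "k \<ge> 1" and X: "uniform_random_vector M k X"
  shows "iid_sample M unif (\<lambda>i \<omega>. X \<omega> i) k"
proof -
  interpret prob_space M by (rule M)
  let ?P = "\<Pi>\<^sub>M i\<in>{1..k}. unif"
  have Xm: "X \<in> M \<rightarrow>\<^sub>M ?P" and Xd: "distr M ?P X = ?P"
    using X unfolding uniform_random_vector_def uniform_cube_def by auto
  have rv: "(\<lambda>\<omega>. X \<omega> i) \<in> M \<rightarrow>\<^sub>M unif" if "i \<in> {1..k}" for i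
    using measurable_compose[OF Xm measurable_component_singleton[OF that]] .
  have d: "distr M unif (\<lambda>\<omega>. X \<omega> i) = unif" if i: "i \<in> {1..k}" for i
  proof -
    have "distr M unif (\<lambda>\<omega>. X \<omega> i) = distr (distr M ?P X) unif (\<lambda>f. f i)"
      using distr_distr[OF measurable_component_singleton[OF i] Xm] by (simp add: o_def)
    also have "\<dots> = unif"
      unfolding Xd by (rule distr_PiM_component[OF _ i]) (rule prob_space_unif)
    finally show ?thesis .
  qed
  have "indep_vars (\<lambda>_. unif) (\<lambda>i \<omega>. X \<omega> i) {1..k}"
  proof (subst indep_vars_iff_distr_eq_PiM')
    \<comment> \<open>Points of the product space are \<open>undefined\<close> outside {1..k}, so
      restricting them changes nothing and the joint law is the given one.\<close>
    have "distr M ?P (\<lambda>\<omega>. \<lambda>i\<in>{1..k}. X \<omega> i) = distr M ?P X"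
    proof (rule distr_cong[OF refl refl])
      fix \<omega> assume "\<omega> \<in> space M"
      then have "X \<omega> \<in> space ?P" by (rule measurable_space[OF Xm])
      then show "(\<lambda>i\<in>{1..k}. X \<omega> i) = X \<omega>"
        by (intro extensional_restrict) (simp add: space_PiM PiE_def)
    qed
    also have "\<dots> = (\<Pi>\<^sub>M i\<in>{1..k}. distr M unif (\<lambda>\<omega>. X \<omega> i))"
      unfolding Xd by (rule PiM_cong) (use d in auto)
    finally show "distr M ?P (\<lambda>\<omega>. \<lambda>i\<in>{1..k}. X \<omega> i) = (\<Pi>\<^sub>M i\<in>{1..k}. distr M unif (\<lambda>\<omega>. X \<omega> i))" .
  qed (use k rv in auto)
  then show ?thesis
    unfolding iid_sample_def iid_sample_axioms_def using M prob_space_unif d by auto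
qed

text \<open>Folding both orders of a pair onto i < j matches the index set of the U-statistic
  bounds; \<open>f\<close> may be asymmetric.\<close>

lemma sum_off_diagonal:
  fixes f :: "nat \<times> nat \<Rightarrow> real"
  shows "(\<Sum>i\<in>{1..k}. \<Sum>j\<in>{1..k}. if i \<noteq> j then f (i, j) else 0) =
    (\<Sum>p | p \<in> {1..k} \<times> {1..k} \<and> fst p < snd p. f p + f (snd p, fst p))"
proof -
  let ?P = "{p. p \<in> {1..k} \<times> {1..k} \<and> fst p < snd p}"
  let ?R = "{p. p \<in> {1..k} \<times> {1..k} \<and> snd p < fst p}"
  have "(\<Sum>i\<in>{1..k}. \<Sum>j\<in>{1..k}. if i \<noteq> j then f (i, j) else 0) =
      (\<Sum>p\<in>{1..k} \<times> {1..k}. if fst p \<noteq> snd p then f p else 0)"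
    unfolding sum.cartesian_product by (rule sum.cong) auto
  also have "\<dots> = sum f (?P \<union> ?R)"
    by (rule sum.mono_neutral_cong_right) auto
  also have "\<dots> = sum f ?P + sum f ?R"
    by (rule sum.union_disjoint) auto
  also have "sum f ?R = (\<Sum>p\<in>?P. f (snd p, fst p))"
    by (rule sum.reindex_bij_witness[where i = prod.swap and j = prod.swap]) auto
  finally show ?thesis by (simp add: sum.distrib)
qed

section \<open>Continuous approximations and Borel versions of kernels\<close>

text \<open>\<open>U\<close> is first clipped at a high level, then the clipped function is
  approximated almost everywhere by continuous ones. Clipping these at the same level bounds them
  and makes dominated convergence on the square available.\<close>

lemma continuous_L1_approximation:
  fixes U :: "real \<times> real \<Rightarrow> real"
  assumes U: "set_integrable lebesgue unit_square U" and \<epsilon>: "\<epsilon> > 0"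
  obtains W B where "continuous_on UNIV W" "\<And>z. \<bar>W z\<bar> \<le> B"
    "(LINT z:unit_square|lebesgue. \<bar>U z - W z\<bar>) < \<epsilon>"
proof -
  define u where "u z = indicator unit_square z *\<^sub>R U z" for z
  have u: "integrable lebesgue u" using U unfolding u_def set_integrable_def .
  define T where "T c x = max (- c) (min c x)" for c x :: real
  have T_bound: "\<bar>T c x\<bar> \<le> c" if "c \<ge> 0" for c x using that unfolding T_def by auto
  have T_diff: "\<bar>x - T c x\<bar> \<le> \<bar>x\<bar>" if "c \<ge> 0" for c x using that unfolding T_def by auto
  have T_eq: "T c x = x" if "\<bar>x\<bar> \<le> c" for c x using that unfolding T_def by auto
  have T_cont: "continuous_on UNIV (T c)" for c unfolding T_def by (intro continuous_intros)
  have T_meas: "(\<lambda>z. T c (v z)) \<in> borel_measurable lebesgue" if "v \<in> borel_measurable lebesgue" for c v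
    using measurable_compose[OF that borel_measurable_continuous_onI[OF T_cont]] .
  have um: "u \<in> borel_measurable lebesgue" using u by simp
  have "(\<lambda>n. LINT z|lebesgue. \<bar>u z - T (real n) (u z)\<bar>) \<longlonglongrightarrow> (LINT z|(lebesgue :: (real \<times> real) measure). 0)"
  proof (rule integral_dominated_convergence[where w = "\<lambda>z. \<bar>u z\<bar>"])
    show "(\<lambda>z. \<bar>u z - T (real n) (u z)\<bar>) \<in> borel_measurable lebesgue" for n
      using um T_meas[OF um] by measurable
    show "AE z in lebesgue. (\<lambda>n. \<bar>u z - T (real n) (u z)\<bar>) \<longlonglongrightarrow> 0"
    proof (rule AE_I2)
      fix z
      have "eventually (\<lambda>n. \<bar>u z - T (real n) (u z)\<bar> = 0) sequentially"
        using eventually_ge_at_top[of "nat \<lceil>\<bar>u z\<bar>\<rceil>"]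
      proof eventually_elim
        case (elim n)
        then have "\<bar>u z\<bar> \<le> real n" by linarith
        then show ?case using T_eq by simp
      qed
      then show "(\<lambda>n. \<bar>u z - T (real n) (u z)\<bar>) \<longlonglongrightarrow> 0" by (rule tendsto_eventually)
    qed
    show "AE z in lebesgue. norm \<bar>u z - T (real n) (u z)\<bar> \<le> \<bar>u z\<bar>" for n
      using T_diff by (intro AE_I2) simp
  qed (use u in auto)
  then have "eventually (\<lambda>n. (LINT z|lebesgue. \<bar>u z - T (real n) (u z)\<bar>) < \<epsilon> / 2) sequentially"
    using \<epsilon> by (intro order_tendstoD(2)) auto
  then obtain n where n: "(LINT z|lebesgue. \<bar>u z - T (real n) (u z)\<bar>) < \<epsilon> / 2"
    by (auto simp: eventually_sequentially)
  \<comment> \<open>\<open>measurable_on\<close> is defined by continuous functions that converge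
    pointwise off a negligible set; these are the source of \<open>W\<close>.\<close>
  have "u measurable_on UNIV" using um by (intro lebesgue_measurable_imp_measurable_on_real) auto
  then obtain N g where N: "negligible N" and g: "\<And>m. continuous_on UNIV (g m)"
    and lim: "\<And>z. z \<notin> N \<Longrightarrow> (\<lambda>m. g m z) \<longlonglongrightarrow> u z"
    unfolding measurable_on_def by auto
  define W where "W m z = T (real n) (g m z)" for m z
  have W_cont: "continuous_on UNIV (W m)" for m
    unfolding W_def by (rule continuous_on_compose2[OF T_cont g]) auto
  have Wm: "W m \<in> borel_measurable lebesgue" for m
    using borel_measurable_continuous_onI[OF W_cont] by (simp add: measurable_completion)
  have sq: "unit_square \<in> sets lebesgue" using lmeasurable_unit_square by (rule fmeasurableD)
  have "(\<lambda>m. LINT z|lebesgue. indicator unit_square z * \<bar>T (real n) (u z) - W m z\<bar>) \<longlonglongrightarrow>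
      (LINT z|(lebesgue :: (real \<times> real) measure). 0)"
  proof (rule integral_dominated_convergence[where w = "\<lambda>z. indicator unit_square z * (2 * real n)"])
    show "(\<lambda>z. indicator unit_square z * \<bar>T (real n) (u z) - W m z\<bar>) \<in> borel_measurable lebesgue" for m
      using T_meas[OF um] Wm[of m] sq by measurable
    show "integrable lebesgue (\<lambda>z. indicator unit_square z * (2 * real n))"
      using set_integrable_unit_square_const[of "2 * real n"] by (simp add: set_integrable_def)
    show "AE z in lebesgue. (\<lambda>m. indicator unit_square z * \<bar>T (real n) (u z) - W m z\<bar>) \<longlonglongrightarrow> 0"
    proof -
      have "N \<in> null_sets lebesgue" using N by (simp add: negligible_iff_null_sets)
      then have "AE z in lebesgue. z \<notin> N" by (rule AE_not_in)
      then show ?thesis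
      proof eventually_elim
        case (elim z)
        have "isCont (T (real n)) (u z)"
          using T_cont by (simp add: continuous_on_eq_continuous_at)
        then have "(\<lambda>m. W m z) \<longlonglongrightarrow> T (real n) (u z)"
          unfolding W_def by (rule isCont_tendsto_compose) (rule lim[OF elim])
        then have "(\<lambda>m. indicator unit_square z * \<bar>T (real n) (u z) - W m z\<bar>) \<longlonglongrightarrow>
            indicator unit_square z * \<bar>T (real n) (u z) - T (real n) (u z)\<bar>"
          by (intro tendsto_intros)
        then show ?case by simp
      qed
    qed
    show "AE z in lebesgue. norm (indicator unit_square z * \<bar>T (real n) (u z) - W m z\<bar>)
        \<le> indicator unit_square z * (2 * real n)" for m
    proof (rule AE_I2)
      fix z
      have "\<bar>T (real n) (u z) - W m z\<bar> \<le> 2 * real n"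
        using T_bound[of "real n" "u z"] T_bound[of "real n" "g m z"] unfolding W_def by linarith
      then show "norm (indicator unit_square z * \<bar>T (real n) (u z) - W m z\<bar>)
        \<le> indicator unit_square z * (2 * real n)" by (simp add: indicator_def)
    qed
  qed simp
  then have "eventually (\<lambda>m. (LINT z|lebesgue. indicator unit_square z * \<bar>T (real n) (u z) - W m z\<bar>) < \<epsilon> / 2) sequentially"
    using \<epsilon> by (intro order_tendstoD(2)) auto
  then obtain m where m: "(LINT z|lebesgue. indicator unit_square z * \<bar>T (real n) (u z) - W m z\<bar>) < \<epsilon> / 2"
    by (auto simp: eventually_sequentially)
  have i1: "integrable lebesgue (\<lambda>z. \<bar>u z - T (real n) (u z)\<bar>)"
    by (rule Bochner_Integration.integrable_bound[OF u]) (use um T_meas[OF um] T_diff in auto)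
  have i2: "integrable lebesgue (\<lambda>z. indicator unit_square z * \<bar>T (real n) (u z) - W m z\<bar>)"
  proof (rule Bochner_Integration.integrable_bound)
    show "integrable lebesgue (\<lambda>z. indicator unit_square z * (2 * real n))"
      using set_integrable_unit_square_const[of "2 * real n"] by (simp add: set_integrable_def)
    show "(\<lambda>z. indicator unit_square z * \<bar>T (real n) (u z) - W m z\<bar>) \<in> borel_measurable lebesgue"
      using T_meas[OF um] Wm[of m] sq by measurable
    show "AE z in lebesgue. norm (indicator unit_square z * \<bar>T (real n) (u z) - W m z\<bar>)
        \<le> norm (indicator unit_square z * (2 * real n))"
    proof (rule AE_I2)
      fix z
      have "\<bar>T (real n) (u z) - W m z\<bar> \<le> 2 * real n"
        using T_bound[of "real n" "u z"] T_bound[of "real n" "g m z"] unfolding W_def by linarith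
      then show "norm (indicator unit_square z * \<bar>T (real n) (u z) - W m z\<bar>)
        \<le> norm (indicator unit_square z * (2 * real n))" by (simp add: indicator_def)
    qed
  qed
  have "(LINT z:unit_square|lebesgue. \<bar>U z - W m z\<bar>) \<le>
      (LINT z|lebesgue. \<bar>u z - T (real n) (u z)\<bar> + indicator unit_square z * \<bar>T (real n) (u z) - W m z\<bar>)"
    unfolding set_lebesgue_integral_def
  proof (rule integral_mono')
    show "integrable lebesgue (\<lambda>z. \<bar>u z - T (real n) (u z)\<bar> + indicator unit_square z * \<bar>T (real n) (u z) - W m z\<bar>)"
      using i1 i2 by (rule Bochner_Integration.integrable_add)
    show "indicator unit_square z *\<^sub>R \<bar>U z - W m z\<bar> \<le>
       \<bar>u z - T (real n) (u z)\<bar> + indicator unit_square z * \<bar>T (real n) (u z) - W m z\<bar>" for z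
      unfolding u_def by (cases "z \<in> unit_square") auto
    show "0 \<le> \<bar>u z - T (real n) (u z)\<bar> + indicator unit_square z * \<bar>T (real n) (u z) - W m z\<bar>" for z
      by simp
  qed
  also have "\<dots> < \<epsilon>"
    using n m by (simp add: Bochner_Integration.integral_add[OF i1 i2])
  finally show ?thesis
    using that[OF W_cont[of m], of "real n"] T_bound unfolding W_def by simp
qed

text \<open>Composing a merely Lebesgue measurable function with Borel random variables need not
  give a random variable. A Borel version on the square repairs this; the fourth power is what the
  truncation argument consumes.\<close>

lemma Lp_sym_Borel_version:
  assumes U: "U \<in> Lp_sym p" and p: "p \<ge> 4"
  obtains U' where "U' \<in> borel_measurable borel"
    and "AE z in lborel. z \<in> unit_square \<longrightarrow> U z = U' z"
    and "integrable (unif \<Otimes>\<^sub>M unif) (\<lambda>z. U' z ^ 4)"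
    and "set_integrable lebesgue unit_square U"
proof -
  have sq: "unit_square \<inter> space lebesgue \<in> sets lebesgue"
    using lmeasurable_unit_square by (simp add: fmeasurableD)
  have m: "(\<lambda>z. indicator unit_square z *\<^sub>R U z) \<in> borel_measurable lebesgue"
    and i: "set_integrable lebesgue unit_square (\<lambda>z. \<bar>U z\<bar> powr p)"
    using U sq unfolding Lp_sym_def set_integrable_def
    by (auto simp: borel_measurable_restrict_space_iff integrable_restrict_space)
  have i1: "set_integrable lebesgue unit_square (\<lambda>z. 1 + \<bar>U z\<bar> powr p)"
    by (intro set_integral_add i set_integrable_unit_square_const)
  obtain U' where U': "U' \<in> borel_measurable lborel"
    and eq: "AE z in lborel. indicator unit_square z *\<^sub>R U z = U' z"
    using completion_ex_borel_measurable_real[OF m] by blast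
  \<comment> \<open>The summand 1 covers \<open>x \<le> 1\<close> and is integrable because the
    square has finite area.\<close>
  have pow: "x ^ 4 \<le> 1 + x powr p" "x \<le> 1 + x powr p" if "x \<ge> 0" for x :: real
  proof -
    have "x ^ 4 \<le> 1 + x powr p \<and> x \<le> 1 + x powr p"
    proof (cases "x \<le> 1")
      case True
      then have "x ^ 4 \<le> 1" using that by (simp add: power_le_one)
      then show ?thesis using True powr_ge_zero[of x p] by linarith
    next
      case False
      then have "x ^ 4 = x powr 4" by (simp add: powr_numeral)
      also have "\<dots> \<le> x powr p" using False p by (intro powr_mono) auto
      finally have "x ^ 4 \<le> x powr p" .
      moreover have "x ^ 1 \<le> x ^ 4" using False by (intro power_increasing) auto
      ultimately show ?thesis by simp
    qed
    then show "x ^ 4 \<le> 1 + x powr p" "x \<le> 1 + x powr p" by auto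
  qed
  have iU: "set_integrable lebesgue unit_square U"
    unfolding set_integrable_def
  proof (rule Bochner_Integration.integrable_bound[OF i1[unfolded set_integrable_def] m])
    show "AE z in lebesgue. norm (indicator unit_square z *\<^sub>R U z)
        \<le> norm (indicator unit_square z *\<^sub>R (1 + \<bar>U z\<bar> powr p))"
      using pow(2)[of "\<bar>U _\<bar>"] by (intro AE_I2) (auto simp: indicator_def)
  qed
  have "set_integrable lebesgue unit_square (\<lambda>z. U' z ^ 4)"
    unfolding set_integrable_def
  proof (rule Bochner_Integration.integrable_bound[OF i1[unfolded set_integrable_def]])
    have "(\<lambda>z. indicator unit_square z *\<^sub>R U' z ^ 4) \<in> borel_measurable lborel"
      using U' unit_square_borel by simp
    then show "(\<lambda>z. indicator unit_square z *\<^sub>R U' z ^ 4) \<in> borel_measurable lebesgue"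
      by (rule measurable_completion)
    show "AE z in lebesgue. norm (indicator unit_square z *\<^sub>R U' z ^ 4)
        \<le> norm (indicator unit_square z *\<^sub>R (1 + \<bar>U z\<bar> powr p))"
      using AE_completion[OF eq]
    proof eventually_elim
      case (elim z)
      show ?case
      proof (cases "z \<in> unit_square")
        case True
        then have "U' z = U z" using elim by simp
        moreover have "\<bar>U z\<bar> ^ 4 = U z ^ 4" by (simp add: power_even_abs)
        moreover have "0 \<le> 1 + \<bar>U z\<bar> powr p" by (intro add_nonneg_nonneg) auto
        ultimately show ?thesis using True pow(1)[of "\<bar>U z\<bar>"] by simp
      qed simp
    qed
  qed
  then have "integrable (unif \<Otimes>\<^sub>M unif) (\<lambda>z. U' z ^ 4)"
    using U' by (subst unif_pair_integral(2)) auto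
  moreover have "AE z in lborel. z \<in> unit_square \<longrightarrow> U z = U' z"
    using eq by eventually_elim auto
  ultimately show ?thesis using that[of U'] U' iU by simp
qed

section \<open>Almost sure convergence\<close>

text \<open>The truncation level \<open>k\<^bsup>2/5\<^esup>\<close> lies between \<open>k\<^bsup>1/3\<^esup>\<close>, needed for the Markov term, and \<open>k\<^bsup>1/2\<^esup>\<close>,
  needed for the Hoeffding term.\<close>

lemma summable_tail_bound:
  assumes \<epsilon>: "\<epsilon> > 0" and \<eta>: "\<eta> > 0"
  shows "summable (\<lambda>k. a * (2 * exp (- 2 * real k * \<eta>\<^sup>2)) +
    (real k * exp (- 2 * real k * \<epsilon>\<^sup>2 / (real k powr (2 / 5))\<^sup>2) + c / ((real k powr (2 / 5)) ^ 3 * \<epsilon>)))"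
proof (intro summable_add summable_mult)
  have e1: "(\<lambda>k. exp (- 2 * real k * \<eta>\<^sup>2)) \<in> O(\<lambda>k. real k powr (- 2))"
    using \<eta> by real_asymp
  \<comment> \<open>The exponent is a negative multiple of k^(1/5), so the exponential decays faster
    than every power of k.\<close>
  have e2: "(\<lambda>k. real k * exp (- 2 * real k * \<epsilon>\<^sup>2 / (real k powr (2 / 5))\<^sup>2)) \<in> O(\<lambda>k. real k powr (- 2))"
    using \<epsilon> by real_asymp
  have s: "summable (\<lambda>k. norm (real k powr (- 2)))" by (simp add: summable_real_powr_iff)
  show "summable (\<lambda>k. exp (- 2 * real k * \<eta>\<^sup>2))"
    by (rule summable_comparison_test_bigo[OF s e1])
  show "summable (\<lambda>k. real k * exp (- 2 * real k * \<epsilon>\<^sup>2 / (real k powr (2 / 5))\<^sup>2))"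
    by (rule summable_comparison_test_bigo[OF s e2])
  have "summable (\<lambda>k. (c / \<epsilon>) * real k powr (- (6 / 5)))"
    by (intro summable_mult) (simp add: summable_real_powr_iff)
  moreover have "(c / \<epsilon>) * real k powr (- (6 / 5)) = c / ((real k powr (2 / 5)) ^ 3 * \<epsilon>)" for k
  proof -
    have "(real k powr (2 / 5)) ^ 3 = real k powr (6 / 5)" 
      by (simp add: power3_eq_cube flip: powr_add)
    then show ?thesis unfolding powr_minus_divide by (simp only: times_divide_times_eq mult_1_right mult.commute[of \<epsilon>])
  qed
  ultimately show "summable (\<lambda>k. c / ((real k powr (2 / 5)) ^ 3 * \<epsilon>))" by (simp only:)
qed

lemma power4_diff_le: "(a - b) ^ 4 \<le> 8 * (a ^ 4 + b ^ 4)" for a b :: real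
proof -
  have sq: "(x - y)\<^sup>2 \<le> 2 * (x\<^sup>2 + y\<^sup>2)" for x y :: real
    using zero_le_power2[of "x + y"] by (simp add: power2_diff power2_sum)
  have "(a - b) ^ 4 = ((a - b)\<^sup>2)\<^sup>2" by simp
  also have "\<dots> \<le> (2 * (a\<^sup>2 + b\<^sup>2))\<^sup>2" by (intro power_mono sq) simp
  also have "\<dots> = 4 * (a\<^sup>2 + b\<^sup>2)\<^sup>2" unfolding power_mult_distrib by simp
  \<comment> \<open>The minus sign turns the sum of squares into a difference, to which
    \<open>sq\<close> applies a second time.\<close>
  also have "\<dots> \<le> 4 * (2 * ((a\<^sup>2)\<^sup>2 + (- (b\<^sup>2))\<^sup>2))"
    using sq[of "a\<^sup>2" "- (b\<^sup>2)"] by (intro mult_left_mono) simp_all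
  finally show ?thesis by simp
qed

text \<open>The distance 3/N is the one from \<open>sorted_sample_close\<close>: the same
  \<open>N\<close> is the resolution of \<open>W\<close> and the grid for the empirical
  distribution.\<close>

lemma uniformly_continuous_unit_square:
  fixes W :: "real \<times> real \<Rightarrow> real"
  assumes W: "continuous_on UNIV W" and \<epsilon>: "\<epsilon> > 0"
  obtains N :: nat where "N > 0"
    and "\<And>a b. a \<in> unit_square \<Longrightarrow> b \<in> unit_square \<Longrightarrow> \<bar>fst a - fst b\<bar> \<le> 3 / real N \<Longrightarrow>
      \<bar>snd a - snd b\<bar> \<le> 3 / real N \<Longrightarrow> \<bar>W a - W b\<bar> \<le> \<epsilon>"
proof -
  have "compact unit_square" by (intro compact_Times) auto
  then have "uniformly_continuous_on unit_square W"
    by (rule compact_uniformly_continuous[rotated]) (rule continuous_on_subset[OF W], simp)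
  then obtain d where d: "d > 0"
    and dW: "\<And>a b. a \<in> unit_square \<Longrightarrow> b \<in> unit_square \<Longrightarrow> dist b a < d \<Longrightarrow> dist (W b) (W a) < \<epsilon>"
    unfolding uniformly_continuous_on_def using \<epsilon> by metis
  \<comment> \<open>The distance in the plane is at most the sum of two coordinate differences, each
    at most 3/N.\<close>
  obtain n :: nat where n: "6 / d < real n" using reals_Archimedean2 by blast
  define N where "N = Suc n"
  have "6 / d < real N" using n unfolding N_def by simp
  then have N: "6 / real N < d" using d unfolding N_def by (simp add: field_simps)
  show ?thesis
  proof (rule that[of N])
    show "N > 0" unfolding N_def by simp
    fix a b :: "real \<times> real"
    assume ab: "a \<in> unit_square" "b \<in> unit_square"
      and le: "\<bar>fst a - fst b\<bar> \<le> 3 / real N" "\<bar>snd a - snd b\<bar> \<le> 3 / real N"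
    have "dist b a = norm (fst b - fst a, snd b - snd a)" by (simp add: dist_norm minus_prod_def)
    also have "\<dots> \<le> \<bar>fst b - fst a\<bar> + \<bar>snd b - snd a\<bar>"
      using norm_Pair_le[of "fst b - fst a" "snd b - snd a"] by simp
    also have "\<dots> \<le> 3 / real N + 3 / real N" using le by (intro add_mono) (auto simp: abs_minus_commute)
    also have "\<dots> < d" using N by simp
    finally show "\<bar>W a - W b\<bar> \<le> \<epsilon>" using dW[OF ab] by (simp add: dist_real_def abs_minus_commute)
  qed
qed

text \<open>The factor 7 consists of 1 for the distance of \<open>U\<close> to \<open>W\<close>, 1
  for the modulus of continuity, 4 for the U-statistic and 1 for the diagonal blocks.
  \<open>W\<close>, \<open>B\<close> and \<open>N\<close> depend on \<open>\<epsilon>\<close> but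
  not on \<open>k\<close>, so each \<open>k\<close> contributes only N + 2 bad events.\<close>

lemma eventually_cut_dist_le:
  fixes X :: "nat \<Rightarrow> 'a \<Rightarrow> nat \<Rightarrow> real"
  assumes p: "p > 4" and M: "prob_space M"
    and X: "\<And>k. k \<ge> 2 \<Longrightarrow> uniform_random_vector M k (X k)"
    and U: "U \<in> Lp_sym p" and \<epsilon>: "\<epsilon> > 0"
  shows "AE \<omega> in M. eventually (\<lambda>k. cut_dist U (sampled_kernel k U (X k \<omega>)) \<le> 7 * \<epsilon>) sequentially"
proof -
  interpret prob_space M by (rule M)
  have iid: "iid_sample M unif (\<lambda>i \<omega>. X k \<omega> i) k" if "k \<ge> 2" for k
    using iid_sample_uniform_random_vector[OF M _ X[OF that]] that by simp
  obtain U' where U'm: "U' \<in> borel_measurable borel"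
    and U'eq: "AE z in lborel. z \<in> unit_square \<longrightarrow> U z = U' z"
    and U'4: "integrable (unif \<Otimes>\<^sub>M unif) (\<lambda>z. U' z ^ 4)"
    and Ui: "set_integrable lebesgue unit_square U"
    by (rule Lp_sym_Borel_version[OF U less_imp_le[OF p]]) (rule that)
  obtain W B where Wc: "continuous_on UNIV W" and WB: "\<And>z. \<bar>W z\<bar> \<le> B"
    and WU: "(LINT z:unit_square|lebesgue. \<bar>U z - W z\<bar>) < \<epsilon>"
    by (rule continuous_L1_approximation[OF Ui \<epsilon>]) (rule that)
  obtain N :: nat where N: "N > 0"
    and modulus: "\<And>a b. a \<in> unit_square \<Longrightarrow> b \<in> unit_square \<Longrightarrow> \<bar>fst a - fst b\<bar> \<le> 3 / real N \<Longrightarrow>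
      \<bar>snd a - snd b\<bar> \<le> 3 / real N \<Longrightarrow> \<bar>W a - W b\<bar> \<le> \<epsilon>"
    by (rule uniformly_continuous_unit_square[OF Wc \<epsilon>]) (rule that)
  have Wm: "W \<in> borel_measurable borel" by (rule borel_measurable_continuous_onI[OF Wc])
  interpret QQ: prob_space "unif \<Otimes>\<^sub>M unif"
    by (rule prob_space_pair) (rule prob_space_unif)+
  interpret unif: prob_space unif by (rule prob_space_unif)
  interpret P: pair_sigma_finite unif unif ..

  define f where "f z = \<bar>U' z - W z\<bar>" for z
  have fm: "f \<in> borel_measurable borel" unfolding f_def using U'm Wm by measurable
  have f0: "0 \<le> f z" for z unfolding f_def by simp
  have Wi: "set_integrable lebesgue unit_square W"
    unfolding unif_pair_integral(2)[OF Wm, symmetric]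
    by (rule QQ.integrable_const_bound[of _ B]) (use WB unif_pair_integral(1)[OF Wm] in auto)
  have UW_eq: "AE z in lebesgue. indicator unit_square z *\<^sub>R \<bar>U z - W z\<bar> = indicator unit_square z *\<^sub>R f z"
    using AE_completion[OF U'eq] by eventually_elim (auto simp: f_def indicator_def)
  have mUW: "(\<lambda>z. indicator unit_square z *\<^sub>R \<bar>U z - W z\<bar>) \<in> borel_measurable lebesgue"
    using set_integrable_abs[OF set_integral_diff(1)[OF Ui Wi]] unfolding set_integrable_def by simp
  have mf: "(\<lambda>z. indicator unit_square z *\<^sub>R f z) \<in> borel_measurable lebesgue"
    using fm unit_square_borel by (intro measurable_completion) simp
  have f_int: "(LINT z|(unif \<Otimes>\<^sub>M unif). f z) < \<epsilon>"
    using WU integral_cong_AE[OF mUW mf UW_eq]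
    unfolding unif_pair_integral(3)[OF fm] set_lebesgue_integral_def by simp
  have f4: "integrable (unif \<Otimes>\<^sub>M unif) (\<lambda>z. f z ^ 4)"
  proof (rule Bochner_Integration.integrable_bound)
    show "integrable (unif \<Otimes>\<^sub>M unif) (\<lambda>z. 8 * (U' z ^ 4 + B ^ 4))" using U'4 by simp
    show "(\<lambda>z. f z ^ 4) \<in> borel_measurable (unif \<Otimes>\<^sub>M unif)"
      using unif_pair_integral(1)[OF fm] by measurable
    show "AE z in unif \<Otimes>\<^sub>M unif. norm (f z ^ 4) \<le> norm (8 * (U' z ^ 4 + B ^ 4))"
    proof (rule AE_I2)
      fix z
      have "f z ^ 4 = (U' z - W z) ^ 4" by (simp add: f_def power_even_abs)
      also have "\<dots> \<le> 8 * (U' z ^ 4 + W z ^ 4)" by (rule power4_diff_le)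
      also have "W z ^ 4 \<le> B ^ 4"
        using power_mono[OF WB[of z], of 4] by (simp add: power_even_abs)
      finally show "norm (f z ^ 4) \<le> norm (8 * (U' z ^ 4 + B ^ 4))" by simp
    qed
  qed
  have fi: "integrable (unif \<Otimes>\<^sub>M unif) f"
  proof (rule Bochner_Integration.integrable_bound)
    show "integrable (unif \<Otimes>\<^sub>M unif) (\<lambda>z. 1 + f z ^ 4)" using f4 by simp
    show "f \<in> borel_measurable (unif \<Otimes>\<^sub>M unif)" by (rule unif_pair_integral(1)[OF fm])
    show "AE z in unif \<Otimes>\<^sub>M unif. norm (f z) \<le> norm (1 + f z ^ 4)"
    proof (rule AE_I2)
      fix z
      have "f z \<le> 1 + f z ^ 4"
      proof (cases "f z \<le> 1")
        case False
        then have "f z ^ 1 \<le> f z ^ 4" by (intro power_increasing) auto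
        then show ?thesis by simp
      qed (use zero_le_power[OF f0[of z], of 4] in linarith)
      then show "norm (f z) \<le> norm (1 + f z ^ 4)" using f0 by simp
    qed
  qed

  \<comment> \<open>\<open>g\<close> collects both orders of a pair, since a Borel version of
    \<open>U\<close> need not be symmetric at every point. Its mean is twice that of
    \<open>f\<close>.\<close>
  define g where "g z = f z + f (snd z, fst z)" for z
  define g' where "g' = (\<lambda>z. f (snd z, fst z))"
  have swapm: "(\<lambda>z::real\<times>real. (snd z, fst z)) \<in> borel_measurable borel"
    by (intro borel_measurable_continuous_onI continuous_intros)
  have g'm: "g' \<in> borel_measurable borel"
    unfolding g'_def using measurable_compose[OF swapm fm] .
  have gm: "g \<in> borel_measurable borel"
    using borel_measurable_add[OF fm g'm] unfolding g_def g'_def .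
  have g0: "0 \<le> g z" for z unfolding g_def using f0 by simp
  have swap: "(LINT z|(unif \<Otimes>\<^sub>M unif). h (snd z, fst z)) = (LINT z|(unif \<Otimes>\<^sub>M unif). h z)"
    "integrable (unif \<Otimes>\<^sub>M unif) (\<lambda>z. h (snd z, fst z)) \<longleftrightarrow> integrable (unif \<Otimes>\<^sub>M unif) h"
    if "h \<in> borel_measurable (unif \<Otimes>\<^sub>M unif)" for h :: "real \<times> real \<Rightarrow> real"
    using P.integral_product_swap[OF that] P.integrable_product_swap_iff[of h]
    unfolding case_prod_beta by simp_all
  have g'i: "integrable (unif \<Otimes>\<^sub>M unif) g'"
    unfolding g'_def using swap(2)[of f] fi by simp
  have gi: "integrable (unif \<Otimes>\<^sub>M unif) g"
    using Bochner_Integration.integrable_add[OF fi g'i] unfolding g_def g'_def .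
  have g_int: "(LINT z|(unif \<Otimes>\<^sub>M unif). g z) < 2 * \<epsilon>"
    using Bochner_Integration.integral_add[OF fi g'i] swap(1)[of f] fi f_int
    unfolding g_def g'_def by simp
  have g4: "integrable (unif \<Otimes>\<^sub>M unif) (\<lambda>z. g z ^ 4)"
  proof (rule Bochner_Integration.integrable_bound)
    show "integrable (unif \<Otimes>\<^sub>M unif) (\<lambda>z. 8 * (f z ^ 4 + f (snd z, fst z) ^ 4))"
      using f4 swap(2)[of "\<lambda>z. f z ^ 4"] by simp
    show "(\<lambda>z. g z ^ 4) \<in> borel_measurable (unif \<Otimes>\<^sub>M unif)"
      using unif_pair_integral(1)[OF gm] by measurable
    show "AE z in unif \<Otimes>\<^sub>M unif. norm (g z ^ 4) \<le> norm (8 * (f z ^ 4 + f (snd z, fst z) ^ 4))"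
    proof (rule AE_I2)
      fix z
      show "norm (g z ^ 4) \<le> norm (8 * (f z ^ 4 + f (snd z, fst z) ^ 4))"
        using power4_diff_le[of "f z" "- f (snd z, fst z)"] unfolding g_def by simp
    qed
  qed

  define F where "F k m = {\<omega> \<in> space M. \<bar>real (card {i \<in> {1..k}. X k \<omega> i \<in> {0..real m / real N}}) / real k
      - measure unif {0..real m / real N}\<bar> \<ge> 1 / real N}" for k m
  define S where "S k \<omega> = (\<Sum>p | p \<in> {1..k} \<times> {1..k} \<and> fst p < snd p. g (X k \<omega> (fst p), X k \<omega> (snd p)))" for k \<omega>
  define E where "E k = {\<omega> \<in> space M. S k \<omega> \<ge> (real k)\<^sup>2 * ((LINT z|(unif \<Otimes>\<^sub>M unif). g z) + 2 * \<epsilon>)}" for k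
  \<comment> \<open>Nothing is assumed about \<open>X 0\<close> and \<open>X 1\<close>, so the first
    two events are set to be empty.\<close>
  define A where "A k = (if k \<ge> 2 then (\<Union>m\<le>N. F k m) \<union> E k else {})" for k
  have grid: "{0..real m / real N} \<in> sets unif" if "m \<le> N" for m
    using that N by (auto simp: sets_restrict_space_iff)
  have F: "F k m \<in> events" "prob (F k m) \<le> 2 * exp (- 2 * real k * (1 / real N)\<^sup>2)"
    if k: "k \<ge> 2" and m: "m \<le> N" for k m
  proof -
    interpret iid_sample M unif "\<lambda>i \<omega>. X k \<omega> i" k by (rule iid[OF k])
    have pos: "0 < 1 / real N" "0 < k" using N k by simp_all
    show "F k m \<in> events" "prob (F k m) \<le> 2 * exp (- 2 * real k * (1 / real N)\<^sup>2)"
      unfolding F_def by (rule empirical_frequency[OF grid[OF m] pos])+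
  qed
  define bound where "bound k = real k * exp (- 2 * real k * \<epsilon>\<^sup>2 / (real k powr (2 / 5))\<^sup>2) +
      (LINT z|(unif \<Otimes>\<^sub>M unif). g z ^ 4) / ((real k powr (2 / 5)) ^ 3 * \<epsilon>)" for k
  have E: "E k \<in> events" "prob (E k) \<le> bound k" if k: "k \<ge> 2" for k
  proof -
    interpret iid_sample M unif "\<lambda>i \<omega>. X k \<omega> i" k by (rule iid[OF k])
    have "S k \<in> borel_measurable M"
      unfolding S_def by (intro borel_measurable_sum rv_pair_compose unif_pair_integral(1)[OF gm]) auto
    then show "E k \<in> events" unfolding E_def by measurable
    show "prob (E k) \<le> bound k"
      unfolding E_def S_def bound_def
      by (rule U_statistic_upper_tail[OF unif_pair_integral(1)[OF gm] g0 gi g4 _ \<epsilon>]) (use k in auto)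
  qed
  have A: "A k \<in> events" for k
  proof (cases "k \<ge> 2")
    case True
    then have "(\<Union>m\<le>N. F k m) \<union> E k \<in> events" by (intro sets.Un sets.finite_UN F E) simp_all
    then show ?thesis using True unfolding A_def by simp
  qed (simp add: A_def)
  have prob_A: "prob (A k) \<le> real (Suc N) * (2 * exp (- 2 * real k * (1 / real N)\<^sup>2)) + bound k" if k: "k \<ge> 2" for k
  proof -
    have "prob (A k) \<le> prob (\<Union>m\<le>N. F k m) + prob (E k)"
    proof -
      have "(\<Union>m\<le>N. F k m) \<in> events" using k by (intro sets.finite_UN F) simp_all
      then show ?thesis using measure_Un_le[OF _ E(1)[OF k]] k unfolding A_def by simp
    qed
    also have "prob (\<Union>m\<le>N. F k m) \<le> (\<Sum>m\<le>N. prob (F k m))"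
      by (rule measure_UNION_le) (use F(1)[OF k] in auto)
    also have "\<dots> \<le> (\<Sum>m\<le>N. 2 * exp (- 2 * real k * (1 / real N)\<^sup>2))"
      by (intro sum_mono F k) auto
    finally show ?thesis using E(2)[OF k] by simp
  qed
  have "summable (\<lambda>k. prob (A k))"
  proof (rule summable_comparison_test')
    show "summable (\<lambda>k. real (Suc N) * (2 * exp (- 2 * real k * (1 / real N)\<^sup>2)) + bound k)"
      unfolding bound_def by (rule summable_tail_bound[OF \<epsilon>]) (use N in simp)
    show "norm (prob (A k)) \<le> real (Suc N) * (2 * exp (- 2 * real k * (1 / real N)\<^sup>2)) + bound k" if "k \<ge> 2" for k
      using prob_A[OF that] by simp
  qed
  then have good: "AE \<omega> in M. eventually (\<lambda>k. \<omega> \<in> space M - A k) sequentially"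
    by (intro borel_cantelli_AE1 A) (auto simp: emeasure_eq_measure)
  \<comment> \<open>For distinct indices the pair has a law absolutely continuous with respect to
    area, so it almost surely avoids the null set where \<open>U\<close> and \<open>U'\<close>
    differ. There are countably many triples, hence one exceptional null set.\<close>
  have same: "AE \<omega> in M. \<forall>k i j. 2 \<le> k \<longrightarrow> i \<in> {1..k} \<longrightarrow> j \<in> {1..k} \<longrightarrow> i \<noteq> j \<longrightarrow>
      (X k \<omega> i, X k \<omega> j) \<in> unit_square \<longrightarrow> U (X k \<omega> i, X k \<omega> j) = U' (X k \<omega> i, X k \<omega> j)"
  proof (unfold AE_all_countable, intro allI)
    fix k i j
    show "AE \<omega> in M. 2 \<le> k \<longrightarrow> i \<in> {1..k} \<longrightarrow> j \<in> {1..k} \<longrightarrow> i \<noteq> j \<longrightarrow>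
      (X k \<omega> i, X k \<omega> j) \<in> unit_square \<longrightarrow> U (X k \<omega> i, X k \<omega> j) = U' (X k \<omega> i, X k \<omega> j)"
    proof (cases "2 \<le> k \<and> i \<in> {1..k} \<and> j \<in> {1..k} \<and> i \<noteq> j")
      case True
      then interpret iid_sample M unif "\<lambda>i \<omega>. X k \<omega> i" k by (intro iid) simp
      have ij: "i \<in> {1..k}" "j \<in> {1..k}" "i \<noteq> j" using True by auto
      have "AE z in distr M (unif \<Otimes>\<^sub>M unif) (\<lambda>\<omega>. (X k \<omega> i, X k \<omega> j)). z \<in> unit_square \<longrightarrow> U z = U' z"
        unfolding distr_pair[OF ij] by (rule AE_unif_pair[OF U'eq])
      from AE_distrD[OF rv_pair[OF ij(1,2)] this] show ?thesis by eventually_elim simp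
    qed auto
  qed
  have range: "X k \<omega> i \<in> {0..1}" if "k \<ge> 2" "i \<in> {1..k}" "\<omega> \<in> space M" for k i \<omega>
  proof -
    interpret iid_sample M unif "\<lambda>i \<omega>. X k \<omega> i" k by (rule iid[OF that(1)])
    show ?thesis using measurable_space[OF rv[OF that(2)] that(3)] by (simp add: space_restrict_space)
  qed
  have "eventually (\<lambda>k. B / real k < \<epsilon>) sequentially"
    using lim_const_over_n[of B] \<epsilon> by (rule order_tendstoD(2))
  then have large: "eventually (\<lambda>k. B / real k < \<epsilon> \<and> 2 \<le> k \<and> N \<le> k) sequentially"
    by (intro eventually_conj eventually_ge_at_top)
  from good same show ?thesis
  proof eventually_elim
    case (elim \<omega>)
    note same_w = elim(2)
    from elim(1) large show ?case
    proof eventually_elim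
      case (elim k)
      then have k: "2 \<le> k" "N \<le> k" "B / real k < \<epsilon>" and w: "\<omega> \<in> space M"
        and nF: "\<And>m. m \<le> N \<Longrightarrow> \<omega> \<notin> F k m" and nE: "\<omega> \<notin> E k"
        by (auto simp: A_def)
      note r = range[OF k(1) _ w]
      have same_k: "\<bar>U (X k \<omega> i, X k \<omega> j) - W (X k \<omega> i, X k \<omega> j)\<bar> = f (X k \<omega> i, X k \<omega> j)"
        if "i \<in> {1..k}" "j \<in> {1..k}" "i \<noteq> j" for i j
        using same_w[rule_format, OF k(1) that] r[OF that(1)] r[OF that(2)] by (auto simp: f_def)
      have cdf: "\<bar>real (card {i \<in> {1..k}. X k \<omega> i \<le> real m / real N}) / real k - real m / real N\<bar> \<le> 1 / real N"
        if m: "m \<le> N" for m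
      proof -
        have "{i \<in> {1..k}. X k \<omega> i \<le> real m / real N} = {i \<in> {1..k}. X k \<omega> i \<in> {0..real m / real N}}"
          using r by auto
        moreover have "measure unif {0..real m / real N} = real m / real N"
          using m N by (simp add: measure_restrict_space)
        ultimately show ?thesis using nF[OF m] w unfolding F_def by auto
      qed
      have "(\<Sum>i\<in>{1..k}. \<Sum>j\<in>{1..k}. if i \<noteq> j then \<bar>U (X k \<omega> i, X k \<omega> j) - W (X k \<omega> i, X k \<omega> j)\<bar> else 0) =
          (\<Sum>i\<in>{1..k}. \<Sum>j\<in>{1..k}. if i \<noteq> j then (\<lambda>q. f (X k \<omega> (fst q), X k \<omega> (snd q))) (i, j) else 0)"
        using same_k by (intro sum.cong refl) simp
      also have "\<dots> = S k \<omega>"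
        by (subst sum_off_diagonal) (simp add: S_def g_def)
      also have "\<dots> < (real k)\<^sup>2 * ((LINT z|(unif \<Otimes>\<^sub>M unif). g z) + 2 * \<epsilon>)"
        using nE w unfolding E_def by simp
      \<comment> \<open>The mean of \<open>g\<close> is below 2\<epsilon>, and the deviation allowed
        in \<open>E\<close> is another 2\<epsilon>.\<close>
      also have "\<dots> < (real k)\<^sup>2 * (4 * \<epsilon>)"
        using g_int k by (intro mult_strict_left_mono) auto
      finally have "(\<Sum>i\<in>{1..k}. \<Sum>j\<in>{1..k}. if i \<noteq> j then \<bar>U (X k \<omega> i, X k \<omega> j) - W (X k \<omega> i, X k \<omega> j)\<bar> else 0)
          / (real k)\<^sup>2 < 4 * \<epsilon>"
        using k by (simp add: divide_less_eq mult.commute)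
      moreover have "cut_dist U (sampled_kernel k U (X k \<omega>)) \<le> (LINT z:unit_square|lebesgue. \<bar>U z - W z\<bar>) + \<epsilon> +
        (\<Sum>i\<in>{1..k}. \<Sum>j\<in>{1..k}. if i \<noteq> j then \<bar>U (X k \<omega> i, X k \<omega> j) - W (X k \<omega> i, X k \<omega> j)\<bar> else 0)
          / (real k)\<^sup>2 + B / real k"
        by (rule cut_dist_sampled_kernel_le[OF Ui Wi WB modulus r N k(2) cdf])
      ultimately show ?case using WU k(3) by linarith
    qed
  qed
qed

theorem corollary2p5:
  fixes p :: real
    and M :: "'a measure"
    and X :: "nat \<Rightarrow> 'a \<Rightarrow> nat \<Rightarrow> real"
    and U :: "real \<times> real \<Rightarrow> real"
  assumes "p > 4"
    and "prob_space M"
    and "\<And>k. k \<ge> 2 \<Longrightarrow> uniform_random_vector M k (X k)"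
    and "U \<in> Lp_sym p"
  shows "AE \<omega> in M. (\<lambda>k. cut_dist U (sampled_kernel k U (X k \<omega>))) \<longlonglongrightarrow> 0"
proof -
  have "set_integrable lebesgue unit_square U"
    by (rule Lp_sym_Borel_version[OF assms(4) less_imp_le[OF assms(1)]])
  then have nonneg: "0 \<le> cut_dist U (sampled_kernel k U (X k \<omega>))" for k \<omega>
    by (rule cut_dist_nonneg[OF _ sampled_kernel_bounded])
  \<comment> \<open>The null set depends on the tolerance, so the tolerance runs through a sequence
    tending to 0 and only countably many null sets are united.\<close>
  have "AE \<omega> in M. \<forall>n. eventually (\<lambda>k. cut_dist U (sampled_kernel k U (X k \<omega>)) \<le> 7 * inverse (real (Suc n))) sequentially"
    unfolding AE_all_countable by (intro allI eventually_cut_dist_le[OF assms(1-3) assms(4)]) simp_all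
  then show ?thesis
  proof eventually_elim
    case (elim \<omega>)
    show ?case
    proof (rule order_tendstoI)
      show "eventually (\<lambda>k. a < cut_dist U (sampled_kernel k U (X k \<omega>))) sequentially" if "a < 0" for a
        by (intro always_eventually allI less_le_trans[OF that nonneg])
      fix a :: real assume "0 < a"
      then obtain n where n: "inverse (real (Suc n)) < a / 7" using reals_Archimedean[of "a / 7"] by auto
      show "eventually (\<lambda>k. cut_dist U (sampled_kernel k U (X k \<omega>)) < a) sequentially"
        using elim[rule_format, of n] by eventually_elim (use n in linarith)
    qed
  qed
qed

end
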